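(* Let $(G,(J_v)_{v\in V},(O_v)_{v\in V},(T_e)_{e\in E})$ be a simple GIFS which satisfies the strong separation condition, bounded distortion, bounded distortion for inverse maps, and $V$-summability. Put $\underline{s}:=\inf\{s\ge0 : P(s\underline{\varphi}^V)\le 0\}$. Then $\underline{s}\le\dim_H K$.
   Context: Fix an integer $D\ge 1$; $|\cdot|$ is the Euclidean norm on $\mathbb{R}^D$, $\|\cdot\|$ the operator norm, $\|M\|_i:=\|M^{-1}\|^{-1}$ for an invertible matrix $M$, $\dim_H$ the Hausdorff dimension. Conventions: suprema of nonnegative quantities over empty sets are $0$, $\inf\emptyset=+\infty$, $\log 0=-\infty$. A GIFS is a system $(G,(J_v)_{v\in V},(O_v)_{v\in V},(T_e)_{e\in E})$ such that: (1) $G=(V,E,i,t)$ is a directed multigraph with countable (finite or infinite) vertex set $V$ and countable edge set $E$, where $i(e),t(e)\in V$ are the initial and terminal vertices of $e\in E$; (2) each $J_v\subset\mathbb{R}^D$ is compact and connected, equals the closure of its interior, and $\sup_v\operatorname{diam}(J_v)<\infty$; (3) each $O_v\subset\mathbb{R}^D$ is bounded, open and connected, and $\inf_v\operatorname{dist}(J_v,\mathbb{R}^D\setminus O_v)>0$; (4) each $T_e$ is a $C^1$-diffeomorphism from $O_{t(e)}$ onto an open subset of $O_{i(e)}$ with $T_e(J_{t(e)})\subset J_{i(e)}$, and there is $r\in(0,1)$ with $\sup_{e\in E}\sup_{x\in O_{t(e)}}\|T_e'(x)\|\le r$. The GIFS is simple if for all $v,u\in V$ there is at most one edge from $v$ to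 $u$; then $E\subset V\times V$, and the edge from $v$ to $u$ is written $vu$, with map $T_{vu}:O_u\to O_v$. No connectivity of $G$ is assumed. For a simple GIFS let $X=\{\omega=\omega_0\omega_1\cdots\in V^{\mathbb{Z}_{\ge0}}:\omega_n\omega_{n+1}\in E\ \text{for all } n\ge 0\}$, let $\sigma$ be the shift $(\sigma\omega)_n=\omega_{n+1}$, define $\pi:X\to\mathbb{R}^D$ by $\{\pi\omega\}=\bigcap_{k\ge0}T_{\omega_0\omega_1}\circ\cdots\circ T_{\omega_k\omega_{k+1}}(J_{\omega_{k+1}})$, and let $K=\pi(X)$ be the limit set. Put $\underline{\varphi}^V(\omega)=\log\|T_{\omega_0\omega_1}'(\pi\sigma\omega)\|_i$ for $\omega\in X$. For a real function $f$ on $X$ the topological pressure is $P(f)=\lim_{n\to\infty}\frac1n\log\sum_{w\in V^n:[w]\ne\emptyset}\exp(\sup_{\omega\in[w]}\sum_{i=0}^{n-1}f(\sigma^i\omega))$, where $[w]=\{\omega\in X:\omega_0\cdots\omega_{n-1}=w\}$. Strong separation condition: $T_e(J_{t(e)}\cap K)\cap T_{e'}(J_{t(e')}\cap K)=\emptyset$ for all $e\ne e'$ in $E$. Bounded distortion: there exist $c_1>0$ and $0<\beta\le1$ such that $\big|\|T_e'(x)\|-\|T_e'(y)\|\big|\le c_1\|T_e'(x)\|\,|x-y|^\beta$ for all $e\in E$ and $x,y\in O_{t(e)}$. Bounded distortion for inverse maps: there exist $c_2>0$ and $0<\beta\le1$ such that $\big|\|T_e'(x)\|_i-\|T_e'(y)\|_i\big|\le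 c_2\|T_e'(x)\|_i\,|x-y|^\beta$ for all $e\in E$ and $x,y\in O_{t(e)}$. $V$-summability: there exists $s\in\underline{I}^V$ with $P(s\underline{\varphi}^V)=0$, where $\underline{I}^V=\{s\ge0:\sum_{v\in V}\sup_{u\in V:\,vu\in E}\sup_{x\in K\cap J_u}\|T_{vu}'(x)\|_i^s<\infty\}$. *)

theory Defs
  imports "HOL-Analysis.Analysis" "Graph_Theory.Digraph"
begin

section \<open>Hausdorff dimension\<close>

text \<open>The case distinction is needed for \<open>d = 0\<close>, where the convention is
  \<open>diam(A)^0 = 1\<close> for every nonempty \<open>A\<close>, including singletons, whereas \<open>0 powr 0 = 0\<close>.\<close>

definition diam_power :: "real \<Rightarrow> 'a::metric_space set \<Rightarrow> ennreal" where
  "diam_power d A =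
     (if A = {} then 0 else if d = 0 then 1 else ennreal (diameter A powr d))"

definition hausdorff_premeasure :: "real \<Rightarrow> real \<Rightarrow> 'a::metric_space set \<Rightarrow> ennreal" where
  "hausdorff_premeasure d \<delta> A =
     (INF C \<in> {C :: nat \<Rightarrow> 'a set. A \<subseteq> (\<Union>n. C n) \<and> (\<forall>n. bounded (C n) \<and> diameter (C n) \<le> \<delta>)}.
        \<Sum>n. diam_power d (C n))"

definition hausdorff_measure :: "real \<Rightarrow> 'a::metric_space set \<Rightarrow> ennreal" where
  "hausdorff_measure d A = (SUP \<delta> \<in> {0<..}. hausdorff_premeasure d \<delta> A)"

definition hausdorff_dim :: "'a::metric_space set \<Rightarrow> ereal" where
  "hausdorff_dim A = Inf {ereal d | d. 0 \<le> d \<and> hausdorff_measure d A = 0}"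


section \<open>Symbolic dynamics\<close>

definition shift :: "(nat \<Rightarrow> 'v) \<Rightarrow> nat \<Rightarrow> 'v" where
  "shift \<omega> = (\<lambda>n. \<omega> (Suc n))"

definition path_space :: "('v, 'e) pre_digraph \<Rightarrow> (nat \<Rightarrow> 'v) set" where
  "path_space G =
     {\<omega>. (\<forall>n. \<omega> n \<in> verts G) \<and> (\<forall>n. (\<omega> n, \<omega> (Suc n)) \<in> arcs_ends G)}"

definition cylinder :: "('v, 'e) pre_digraph \<Rightarrow> 'v list \<Rightarrow> (nat \<Rightarrow> 'v) set" where
  "cylinder G w = {\<omega> \<in> path_space G. map \<omega> [0..<length w] = w}"

definition exp_ereal :: "ereal \<Rightarrow> ennreal" where
  "exp_ereal x = (if x = \<infinity> then \<infinity> else if x = -\<infinity> then 0 else ennreal (exp (real_of_ereal x)))"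

definition log_ennreal :: "ennreal \<Rightarrow> ereal" where
  "log_ennreal x = (if x = 0 then -\<infinity> else if x = \<infinity> then \<infinity> else ereal (ln (enn2real x)))"

text \<open>The supremum, the sum and the limit are all taken in the extended reals. The limit
  is meaningful (it exists) for potentials that are bounded above by \<open>0\<close>: then the partition
  function is submultiplicative and decreasing in \<open>n\<close>.\<close>

definition partition_function ::
    "('v, 'e) pre_digraph \<Rightarrow> ((nat \<Rightarrow> 'v) \<Rightarrow> real) \<Rightarrow> nat \<Rightarrow> ennreal" where
  "partition_function G f n =
     (\<Sum>\<^sub>\<infinity>w \<in> {w. length w = n \<and> set w \<subseteq> verts G \<and> cylinder G w \<noteq> {}}.
        exp_ereal (SUP \<omega> \<in> cylinder G w. ereal (\<Sum>i<n. f ((shift ^^ i) \<omega>))))"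

definition pressure :: "('v, 'e) pre_digraph \<Rightarrow> ((nat \<Rightarrow> 'v) \<Rightarrow> real) \<Rightarrow> ereal" where
  "pressure G f = lim (\<lambda>n. ereal (1 / real n) * log_ennreal (partition_function G f n))"


section \<open>Graph iterated function systems\<close>

text \<open>\<open>conorm M\<close> is the quantity \<open>\<parallel>M\<parallel>\<^sub>i = \<parallel>M\<^sup>-\<^sup>1\<parallel>\<^sup>-\<^sup>1\<close> for an invertible linear map \<open>M\<close>.\<close>

definition conorm :: "('a::real_normed_vector \<Rightarrow> 'a) \<Rightarrow> real" where
  "conorm M = inverse (onorm (inv M))"

abbreviation deriv_at ::
    "('a::real_normed_vector \<Rightarrow> 'a) \<Rightarrow> 'a \<Rightarrow> 'a \<Rightarrow> 'a" where
  "deriv_at f x \<equiv> frechet_derivative f (at x)"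

definition C1_on :: "'a::real_normed_vector set \<Rightarrow> ('a \<Rightarrow> 'a) \<Rightarrow> bool" where
  "C1_on A f \<longleftrightarrow>
     (\<exists>f' :: 'a \<Rightarrow> 'a \<Rightarrow>\<^sub>L 'a.
        (\<forall>x\<in>A. (f has_derivative blinfun_apply (f' x)) (at x)) \<and> continuous_on A f')"

definition C1_diffeo_onto_open :: "'a::real_normed_vector set \<Rightarrow> ('a \<Rightarrow> 'a) \<Rightarrow> bool" where
  "C1_diffeo_onto_open A f \<longleftrightarrow>
     C1_on A f \<and> inj_on f A \<and> open (f ` A) \<and> C1_on (f ` A) (inv_into A f)"

text \<open>In the directed multigraph \<open>G\<close> the initial vertex of an edge \<open>e\<close> is \<open>tail G e\<close> and its
  terminal vertex is \<open>head G e\<close>. The map of an edge is a total function, but only its values on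
  the open set attached to the terminal vertex matter.

  The sets \<open>J v\<close> are required to be nonempty (as is implicit in speaking of a connected
  set), without which the coding map below would not be defined; this also
  excludes empty arguments of \<open>setdist\<close>, where it is \<open>0\<close>.\<close>

locale gifs = wf_digraph G
  for G :: "('v, 'e) pre_digraph" (structure) +
  fixes J :: "'v \<Rightarrow> (real ^ 'n) set"
    and U :: "'v \<Rightarrow> (real ^ 'n) set"
    and T :: "'e \<Rightarrow> real ^ 'n \<Rightarrow> real ^ 'n"
  assumes countable_verts: "countable (verts G)"
    and countable_arcs: "countable (arcs G)"
    and J_set: "\<And>v. v \<in> verts G \<Longrightarrow>
      J v \<noteq> {} \<and> compact (J v) \<and> connected (J v) \<and> J v = closure (interior (J v))"
    and J_diam: "bdd_above ((\<lambda>v. diameter (J v)) ` verts G)"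
    and U_set: "\<And>v. v \<in> verts G \<Longrightarrow> bounded (U v) \<and> open (U v) \<and> connected (U v)"
    and J_U_dist: "\<exists>\<delta>>0. \<forall>v\<in>verts G. \<delta> \<le> setdist (J v) (- U v)"
    and T_diffeo: "\<And>e. e \<in> arcs G \<Longrightarrow> C1_diffeo_onto_open (U (head G e)) (T e)"
    and T_U: "\<And>e. e \<in> arcs G \<Longrightarrow> T e ` U (head G e) \<subseteq> U (tail G e)"
    and T_J: "\<And>e. e \<in> arcs G \<Longrightarrow> T e ` J (head G e) \<subseteq> J (tail G e)"
    and T_contraction: "\<exists>r. 0 < r \<and> r < 1 \<and>
      (\<forall>e\<in>arcs G. \<forall>x\<in>U (head G e). onorm (deriv_at (T e) x) \<le> r)"

locale simple_gifs = gifs G J U T + nomulti_digraph G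
  for G :: "('v, 'e) pre_digraph" (structure)
    and J :: "'v \<Rightarrow> (real ^ 'n) set"
    and U :: "'v \<Rightarrow> (real ^ 'n) set"
    and T :: "'e \<Rightarrow> real ^ 'n \<Rightarrow> real ^ 'n"

text \<open>The edge \<open>vu\<close> of a simple system.\<close>

definition edge :: "('v, 'e) pre_digraph \<Rightarrow> 'v \<Rightarrow> 'v \<Rightarrow> 'e" where
  "edge G v u = (THE e. e \<in> arcs G \<and> tail G e = v \<and> head G e = u)"

primrec path_map ::
    "('v, 'e) pre_digraph \<Rightarrow> ('e \<Rightarrow> 'a \<Rightarrow> 'a) \<Rightarrow> (nat \<Rightarrow> 'v) \<Rightarrow> nat \<Rightarrow> 'a \<Rightarrow> 'a" where
  "path_map G T \<omega> 0 = T (edge G (\<omega> 0) (\<omega> 1))"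
| "path_map G T \<omega> (Suc k) =
     path_map G T \<omega> k \<circ> T (edge G (\<omega> (Suc k)) (\<omega> (Suc (Suc k))))"

definition coding_map ::
    "('v, 'e) pre_digraph \<Rightarrow> ('v \<Rightarrow> 'a set) \<Rightarrow> ('e \<Rightarrow> 'a \<Rightarrow> 'a) \<Rightarrow> (nat \<Rightarrow> 'v) \<Rightarrow> 'a" where
  "coding_map G J T \<omega> = (THE x. {x} = (\<Inter>k. path_map G T \<omega> k ` J (\<omega> (Suc k))))"

definition limit_set ::
    "('v, 'e) pre_digraph \<Rightarrow> ('v \<Rightarrow> 'a set) \<Rightarrow> ('e \<Rightarrow> 'a \<Rightarrow> 'a) \<Rightarrow> 'a set" where
  "limit_set G J T = coding_map G J T ` path_space G"

definition lower_potential ::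
    "('v, 'e) pre_digraph \<Rightarrow> ('v \<Rightarrow> (real ^ 'n) set) \<Rightarrow> ('e \<Rightarrow> real ^ 'n \<Rightarrow> real ^ 'n) \<Rightarrow>
      (nat \<Rightarrow> 'v) \<Rightarrow> real" where
  "lower_potential G J T \<omega> =
     ln (conorm (deriv_at (T (edge G (\<omega> 0) (\<omega> 1))) (coding_map G J T (shift \<omega>))))"

definition strong_separation ::
    "('v, 'e) pre_digraph \<Rightarrow> ('v \<Rightarrow> 'a set) \<Rightarrow> ('e \<Rightarrow> 'a \<Rightarrow> 'a) \<Rightarrow> bool" where
  "strong_separation G J T \<longleftrightarrow>
     (\<forall>e\<in>arcs G. \<forall>e'\<in>arcs G. e \<noteq> e' \<longrightarrow>
        T e ` (J (head G e) \<inter> limit_set G J T) \<inter>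
        T e' ` (J (head G e') \<inter> limit_set G J T) = {})"

definition bounded_distortion ::
    "('v, 'e) pre_digraph \<Rightarrow> ('v \<Rightarrow> (real ^ 'n) set) \<Rightarrow> ('e \<Rightarrow> real ^ 'n \<Rightarrow> real ^ 'n) \<Rightarrow> bool" where
  "bounded_distortion G U T \<longleftrightarrow>
     (\<exists>c>0. \<exists>\<beta>. 0 < \<beta> \<and> \<beta> \<le> 1 \<and>
        (\<forall>e\<in>arcs G. \<forall>x\<in>U (head G e). \<forall>y\<in>U (head G e).
           \<bar>onorm (deriv_at (T e) x) - onorm (deriv_at (T e) y)\<bar>
             \<le> c * onorm (deriv_at (T e) x) * norm (x - y) powr \<beta>))"

definition bounded_distortion_inverse ::
    "('v, 'e) pre_digraph \<Rightarrow> ('v \<Rightarrow> (real ^ 'n) set) \<Rightarrow> ('e \<Rightarrow> real ^ 'n \<Rightarrow> real ^ 'n) \<Rightarrow> bool" where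
  "bounded_distortion_inverse G U T \<longleftrightarrow>
     (\<exists>c>0. \<exists>\<beta>. 0 < \<beta> \<and> \<beta> \<le> 1 \<and>
        (\<forall>e\<in>arcs G. \<forall>x\<in>U (head G e). \<forall>y\<in>U (head G e).
           \<bar>conorm (deriv_at (T e) x) - conorm (deriv_at (T e) y)\<bar>
             \<le> c * conorm (deriv_at (T e) x) * norm (x - y) powr \<beta>))"

definition V_summability_exponents ::
    "('v, 'e) pre_digraph \<Rightarrow> ('v \<Rightarrow> (real ^ 'n) set) \<Rightarrow> ('e \<Rightarrow> real ^ 'n \<Rightarrow> real ^ 'n) \<Rightarrow>
      real set" where
  "V_summability_exponents G J T =
     {s. 0 \<le> s \<and>
        (\<Sum>\<^sub>\<infinity>v \<in> verts G.
           SUP u \<in> {u \<in> verts G. (v, u) \<in> arcs_ends G}. SUP x \<in> limit_set G J T \<inter> J u.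
             ennreal (conorm (deriv_at (T (edge G v u)) x) powr s)) < \<infinity>}"

definition V_summable ::
    "('v, 'e) pre_digraph \<Rightarrow> ('v \<Rightarrow> (real ^ 'n) set) \<Rightarrow> ('e \<Rightarrow> real ^ 'n \<Rightarrow> real ^ 'n) \<Rightarrow> bool" where
  "V_summable G J T \<longleftrightarrow>
     (\<exists>s\<in>V_summability_exponents G J T.
        pressure G (\<lambda>\<omega>. s * lower_potential G J T \<omega>) = 0)"

definition lower_dim ::
    "('v, 'e) pre_digraph \<Rightarrow> ('v \<Rightarrow> (real ^ 'n) set) \<Rightarrow> ('e \<Rightarrow> real ^ 'n \<Rightarrow> real ^ 'n) \<Rightarrow> ereal" where
  "lower_dim G J T =
     Inf {ereal s | s. 0 \<le> s \<and> pressure G (\<lambda>\<omega>. s * lower_potential G J T \<omega>) \<le> 0}"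

end

theory Submission
  imports Defs
begin

text \<open>
  Let \<open>s\<close> be the exponent supplied by summability, so that the
  pressure of \<open>s\<phi>\<close>, \<open>\<phi>\<close> the lower potential, is \<open>0\<close>. Since \<open>s\<close> itself competes in the infimum
  that defines the lower dimension, it suffices to show that the Hausdorff measure of the limit set
  in every dimension \<open>d < s\<close> is nonzero. Fix \<open>t\<close> strictly between \<open>d\<close> and \<open>s\<close>, and write
  \<open>S\<^sub>n\<phi>\<close> for the Birkhoff sums.

  The graph need not be connected, so there is no irreducible matrix or conformal measure to
  start from. Instead, the proof looks at the loops of a fixed length \<open>l\<close> at a vertex \<open>v\<close> and
  distinguishes two cases.

  \<^bold>\<open>Some vertex has many loops.\<close> Suppose that finitely many loops \<open>L\<close> of length \<open>l\<close> at \<open>v\<close> have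
  weights \<open>w(L) \<le> exp (S\<^sub>l\<phi>)\<close> (on all paths through \<open>L\<close>) with \<open>\<Sum> w(L)\<^sup>t \<ge> 1\<close>. Concatenating these
  loops freely gives a subset of the limit set that is indexed by the infinite sequences of loops.
  Strong separation and compactness keep the images of different first loops at a positive
  distance (\<open>loops_separated\<close>), and bounded distortion of the inverses propagates this
  through the maps: sequences that first differ at place \<open>k\<close> are coded to points at distance at
  least a constant times the product of the first \<open>k\<close> weights (\<open>dist_coding_map_ge\<close>). A mass
  distribution argument on the tree of finite sequences
  (\<open>hausdorff_measure_pos_of_separated_tree\<close>) then shows that the \<open>d\<close>-dimensional measure is
  positive (\<open>hausdorff_measure_limit_set_pos\<close>).

  \<^bold>\<open>No vertex has many loops.\<close> Comparing the exponents \<open>t\<close> and \<open>s\<close> gains a factor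
  \<open>r\<^sup>s\<^sup>-\<^sup>t\<close> per letter, where \<open>r < 1\<close> bounds the contraction. So for each vertex the
  total \<open>s\<close>-weight of its loops of length \<open>n\<close> decays like \<open>\<theta>\<^sup>n\<close> with \<open>\<theta> = r\<^sup>s\<^sup>-\<^sup>t < 1\<close>
  (\<open>loop_weight_sum_le\<close>). Choose \<open>x > 1\<close> with \<open>x\<theta> < 1\<close> and form the generating function of all
  words, a word \<open>w\<close> of length \<open>n\<close> contributing \<open>x\<^sup>n\<close> times its \<open>s\<close>-weight. By summability,
  all but finitely many vertices together have so little weight that the generating function of
  the words avoiding these finitely many vertices converges as a geometric series. Admit the
  exceptional vertices one at a time: a word that visits a new vertex \<open>v\<close> splits at its first and
  last visit into a word without \<open>v\<close>, a loop at \<open>v\<close>, the letter \<open>v\<close>, and a word without \<open>v\<close>, so the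
  generating function stays finite (\<open>gen_function_insert\<close>). Its finiteness at \<open>x > 1\<close> bounds the
  partition function by a constant times \<open>x\<^sup>-\<^sup>n\<close>, so the pressure is at most \<open>- ln x < 0\<close>, a
  contradiction. The limit defining the pressure exists by Fekete's lemma, as the partition function
  is submultiplicative.
\<close>

section \<open>Mass distribution on trees\<close>

text \<open>Dependent choice on finite words. It stands in for the construction of a measure on sequence
  space as well as for the compactness of that space.\<close>

lemma infinite_branch:
  assumes "P []"
    and step: "\<And>u. P u \<Longrightarrow> set u \<subseteq> A \<Longrightarrow> \<exists>a\<in>A. P (u @ [a])"
  obtains x :: "nat \<Rightarrow> 'a" where "\<And>n. x n \<in> A" "\<And>k. P (map x [0..<k])"
proof -
  define nxt where "nxt u = (SOME a. a \<in> A \<and> P (u @ [a]))" for u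
  have nxt: "nxt u \<in> A \<and> P (u @ [nxt u])" if "P u" "set u \<subseteq> A" for u
    unfolding nxt_def by (rule someI_ex) (use step that in blast)
  define F where "F k = ((\<lambda>u. u @ [nxt u]) ^^ k) []" for k
  have F: "P (F k) \<and> set (F k) \<subseteq> A" for k
    by (induction k) (use assms(1) nxt in \<open>auto simp: F_def\<close>)
  have "map (\<lambda>k. nxt (F k)) [0..<k] = F k" for k
    by (induction k) (auto simp: F_def)
  with F nxt show ?thesis
    by (intro that[of "\<lambda>k. nxt (F k)"]) auto
qed

text \<open>This lets one exponent \<open>t > 0\<close> serve for all dimensions \<open>d \<le> t\<close>, including \<open>d = 0\<close> with its
  special convention.\<close>

lemma diam_power_ge_diameter_powr:
  assumes "0 < t" "d \<le> t" "0 \<le> d" "bounded A" "diameter A \<le> 1"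
  shows "ennreal (diameter A powr t) \<le> diam_power d A"
proof -
  have "0 \<le> diameter A" using assms by (simp add: diameter_ge_0)
  then show ?thesis
    using assms by (auto simp: diam_power_def intro!: ennreal_leI powr_mono' powr_le1)
qed

text \<open>The mass distribution principle without a measure. Distribute mass over the tree of finite
  words by \<open>q(u) = \<Prod> c(a)\<^sup>t\<close>, which loses nothing from a word to its children. Suppose a cover has
  total \<open>t\<close>-cost below \<open>\<eta> = \<kappa>\<^sup>t\<close>. Charge each covering set to the words \<open>u\<close> such that it meets the
  tree only below \<open>u\<close>. If the charge at \<open>u\<close> is below \<open>\<eta> q(u)\<close>, the same holds at one of the children,
  since the charges of different children come from disjoint families. Following such children
  yields an infinite sequence whose point lies in some covering set. That set is charged along the
  sequence up to a last word \<open>u\<close>, and it contains points from two different branches at \<open>u\<close>;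
  hence its diameter is at least \<open>\<kappa> \<Prod> c(a)\<close> and its cost alone exceeds the charge allowed at \<open>u\<close>.\<close>

lemma hausdorff_measure_pos_of_separated_tree:
  fixes \<pi> :: "(nat \<Rightarrow> 'w) \<Rightarrow> 'a::metric_space"
  assumes fin: "finite W"
    and c: "\<And>a. a \<in> W \<Longrightarrow> 0 < c a \<and> c a \<le> \<rho>" and \<rho>: "\<rho> < 1"
    and t: "0 < t" and weights: "1 \<le> (\<Sum>a\<in>W. c a powr t)"
    and \<kappa>: "0 < \<kappa>"
    and sep: "\<And>x y k. range x \<subseteq> W \<Longrightarrow> range y \<subseteq> W \<Longrightarrow> (\<And>j. j < k \<Longrightarrow> x j = y j) \<Longrightarrow>
      x k \<noteq> y k \<Longrightarrow> \<kappa> * (\<Prod>j<k. c (x j)) \<le> dist (\<pi> x) (\<pi> y)"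
    and K: "\<And>x. range x \<subseteq> W \<Longrightarrow> \<pi> x \<in> K"
    and d: "0 \<le> d" "d \<le> t"
  shows "hausdorff_measure d K \<noteq> 0"
proof
  assume H0: "hausdorff_measure d K = 0"
  define \<eta> where "\<eta> = \<kappa> powr t"
  have \<eta>: "0 < \<eta>" using \<kappa> by (simp add: \<eta>_def)
  have "hausdorff_premeasure d 1 K \<le> hausdorff_measure d K"
    unfolding hausdorff_measure_def by (rule SUP_upper) simp
  with H0 have "hausdorff_premeasure d 1 K < ennreal (\<eta> / 2)" using \<eta> by simp
  then obtain C where C: "K \<subseteq> (\<Union>n. C n)" "\<And>n. bounded (C n)" "\<And>n. diameter (C n) \<le> 1"
    and sumC: "(\<Sum>n. diam_power d (C n)) < ennreal (\<eta> / 2)"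
    unfolding hausdorff_premeasure_def INF_less_iff by auto
  \<comment> \<open>Covering sets may have diameter \<open>0\<close>. The summable padding \<open>e\<close> makes every cost positive, so that no
    set can stay charged along a whole branch, where the masses tend to \<open>0\<close>.\<close>
  define e where "e n = \<eta> / 2 * (1 / 2) ^ Suc n" for n
  have e: "0 < e n" for n using \<eta> by (simp add: e_def)
  define b where "b n = ennreal (diameter (C n) powr t) + ennreal (e n)" for n
  have "e sums (\<eta> / 2 * 1)" unfolding e_def
    by (intro sums_mult power_half_series)
  then have sume: "(\<Sum>n. ennreal (e n)) = ennreal (\<eta> / 2)"
    using e by (subst suminf_ennreal_eq) (auto simp: less_imp_le)
  have "(\<Sum>n. b n) = (\<Sum>n. ennreal (diameter (C n) powr t)) + ennreal (\<eta> / 2)"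
    unfolding b_def sume[symmetric] by (rule suminf_add[symmetric]) auto
  also have "\<dots> \<le> (\<Sum>n. diam_power d (C n)) + ennreal (\<eta> / 2)"
    by (intro add_right_mono suminf_le diam_power_ge_diameter_powr) (use t d C in auto)
  also have "\<dots> < ennreal (\<eta> / 2) + ennreal (\<eta> / 2)"
    using sumC by (subst add.commute, subst (2) add.commute, intro ennreal_add_left_cancel_less[THEN iffD2]) auto
  also have "\<dots> = ennreal \<eta>" using \<eta> by (simp flip: ennreal_plus)
  finally have sumb: "(\<Sum>n. b n) < ennreal \<eta>" .
  define \<mu> where "\<mu> = density (count_space (UNIV::nat set)) b"
  have sets\<mu>[simp]: "A \<in> sets \<mu>" for A by (simp add: \<mu>_def)
  have \<mu>UNIV: "emeasure \<mu> UNIV = (\<Sum>n. b n)"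
    by (simp add: \<mu>_def emeasure_density nn_integral_count_space_nat)
  have \<mu>1: "b n \<le> emeasure \<mu> A" if "n \<in> A" for n A
  proof -
    have "b n = emeasure \<mu> {n}"
      by (simp add: \<mu>_def emeasure_density nn_integral_count_space_indicator[symmetric]
          nn_integral_count_space_finite)
    also have "\<dots> \<le> emeasure \<mu> A" by (rule emeasure_mono) (use that in auto)
    finally show ?thesis .
  qed
  define N where "N u = {n. (\<exists>x. range x \<subseteq> W \<and> \<pi> x \<in> C n) \<and>
    (\<forall>x. range x \<subseteq> W \<longrightarrow> \<pi> x \<in> C n \<longrightarrow> map x [0..<length u] = u)}" for u
  define q where "q u = (\<Prod>a\<leftarrow>u. c a powr t)" for u
  have q0: "0 \<le> q u" for u unfolding q_def by (induction u) auto
  have "\<exists>a\<in>W. emeasure \<mu> (N (u @ [a])) < ennreal (\<eta> * q (u @ [a]))"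
    if u: "emeasure \<mu> (N u) < ennreal (\<eta> * q u)" for u
  proof (rule ccontr)
    assume "\<not> ?thesis"
    then have *: "ennreal (\<eta> * q (u @ [a])) \<le> emeasure \<mu> (N (u @ [a]))" if "a \<in> W" for a
      using that by (auto simp: not_less)
    have disj: "disjoint_family_on (\<lambda>a. N (u @ [a])) W"
      unfolding disjoint_family_on_def N_def by fastforce
    have "ennreal (\<eta> * q u) \<le> ennreal (\<Sum>a\<in>W. \<eta> * q (u @ [a]))"
      using weights q0[of u] \<eta> mult_left_mono[OF weights, of "\<eta> * q u"]
      by (intro ennreal_leI) (simp add: q_def sum_distrib_left[symmetric] mult.assoc)
    also have "\<dots> = (\<Sum>a\<in>W. ennreal (\<eta> * q (u @ [a])))"
      using q0 \<eta> by (subst sum_ennreal) auto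
    also have "\<dots> \<le> (\<Sum>a\<in>W. emeasure \<mu> (N (u @ [a])))"
      by (intro sum_mono *)
    also have "\<dots> = emeasure \<mu> (\<Union>a\<in>W. N (u @ [a]))"
      by (rule sum_emeasure) (use disj fin in auto)
    also have "\<dots> \<le> emeasure \<mu> (N u)"
      by (rule emeasure_mono) (auto simp: N_def)
    finally show False using u by simp
  qed
  moreover have "emeasure \<mu> (N []) < ennreal (\<eta> * q [])"
    using sumb emeasure_mono[of "N []" UNIV \<mu>] by (simp add: q_def \<mu>UNIV)
  ultimately obtain x where x: "\<And>n. x n \<in> W"
    and small: "\<And>k. emeasure \<mu> (N (map x [0..<k])) < ennreal (\<eta> * q (map x [0..<k]))"
    using infinite_branch[of "\<lambda>u. emeasure \<mu> (N u) < ennreal (\<eta> * q u)" W] by metis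
  have q_eq: "q (map x [0..<k]) = (\<Prod>j<k. c (x j)) powr t" for k
  proof (induction k)
    case (Suc k)
    have "0 \<le> (\<Prod>j<k. c (x j))" using c x by (intro prod_nonneg) (auto simp: less_imp_le)
    moreover have "0 \<le> c (x k)" using c x by (auto simp: less_imp_le)
    ultimately show ?case using Suc by (simp add: q_def powr_mult)
  qed (simp add: q_def)
  have rx: "range x \<subseteq> W" using x by auto
  obtain n where n: "\<pi> x \<in> C n" using K[OF rx] C by auto
  have "\<exists>k. n \<notin> N (map x [0..<k])"
  proof (rule ccontr)
    assume "\<not> ?thesis"
    then have nN: "n \<in> N (map x [0..<k])" for k by auto
    have "0 < \<rho>" using c[OF x[of 0]] by linarith
    then have \<rho>t: "0 < \<rho> powr t" "\<rho> powr t < 1" using \<rho> t powr_less_mono2[of t \<rho> 1] by auto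
    obtain k where k: "(\<rho> powr t) ^ k < e n / \<eta>"
      using real_arch_pow_inv[of "e n / \<eta>" "\<rho> powr t"] \<rho>t e \<eta> by auto
    have "(\<Prod>j<k. c (x j)) \<le> (\<Prod>j<k. \<rho>)"
      using c x by (intro prod_mono) (auto simp: less_imp_le)
    moreover have "0 \<le> (\<Prod>j<k. c (x j))" using c x by (intro prod_nonneg) (auto simp: less_imp_le)
    ultimately have "q (map x [0..<k]) \<le> (\<rho> ^ k) powr t"
      unfolding q_eq using t by (intro powr_mono2) auto
    also have "\<dots> = (\<rho> powr t) ^ k"
      using \<open>0 < \<rho>\<close> by (simp add: powr_powr powr_realpow[symmetric] mult.commute)
    also have "\<dots> \<le> e n / \<eta>" using k by simp
    finally have "\<eta> * q (map x [0..<k]) \<le> e n"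
      using \<eta> by (simp add: field_simps)
    then have "ennreal (\<eta> * q (map x [0..<k])) \<le> ennreal (e n)" by (rule ennreal_leI)
    also have "\<dots> \<le> b n" by (simp add: b_def)
    also have "\<dots> \<le> emeasure \<mu> (N (map x [0..<k]))" by (rule \<mu>1[OF nN])
    finally show False using small[of k] by simp
  qed
  \<comment> \<open>the first initial segment to which the set covering the point of \<open>x\<close> is not charged\<close>
  then obtain m where m: "n \<notin> N (map x [0..<m])" "\<And>j. j < m \<Longrightarrow> n \<in> N (map x [0..<j])"
    using exists_least_iff[of "\<lambda>k. n \<notin> N (map x [0..<k])"] by auto
  have "m \<noteq> 0" using m n rx by (auto simp: N_def)
  then obtain k where k: "m = Suc k" using not0_implies_Suc by blast
  have nk: "n \<in> N (map x [0..<k])" using m k by simp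
  obtain y where y: "range y \<subseteq> W" "\<pi> y \<in> C n" "map y [0..<Suc k] \<noteq> map x [0..<Suc k]"
    using m(1) n rx unfolding k N_def by auto
  have yk: "map y [0..<k] = map x [0..<k]" using nk y unfolding N_def by auto
  have "\<kappa> * (\<Prod>j<k. c (x j)) \<le> dist (\<pi> x) (\<pi> y)"
    using yk y(3) by (intro sep rx y) (auto simp: map_eq_conv)
  also have "\<dots> \<le> diameter (C n)"
    using diameter_bounded_bound[OF C(2) n y(2)] .
  finally have "(\<kappa> * (\<Prod>j<k. c (x j))) powr t \<le> diameter (C n) powr t"
    using \<kappa> t c x by (intro powr_mono2 mult_nonneg_nonneg prod_nonneg) (auto simp: less_imp_le)
  moreover have "(\<kappa> * (\<Prod>j<k. c (x j))) powr t = \<eta> * q (map x [0..<k])"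
    using \<kappa> c x by (auto simp: \<eta>_def q_eq intro!: powr_mult prod_nonneg less_imp_le)
  ultimately have "ennreal (\<eta> * q (map x [0..<k])) \<le> ennreal (diameter (C n) powr t)"
    by (intro ennreal_leI) simp
  also have "\<dots> \<le> b n" by (simp add: b_def)
  also have "\<dots> \<le> emeasure \<mu> (N (map x [0..<k]))" by (rule \<mu>1[OF nk])
  finally show False using small[of k] by simp
qed

section \<open>Metric estimates for diffeomorphisms\<close>

text \<open>The derivative of a diffeomorphism is a bijection whose inverse is the derivative of the
  inverse map, so \<open>conorm\<close> has the intended meaning.\<close>

lemma C1_diffeo_derivative:
  fixes f :: "'a::euclidean_space \<Rightarrow> 'a"
  assumes f: "C1_diffeo_onto_open A f" and A: "open A" and x: "x \<in> A"
  shows "(f has_derivative deriv_at f x) (at x)"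
    and "(inv_into A f has_derivative inv (deriv_at f x)) (at (f x))"
    and "0 < conorm (deriv_at f x)"
    and "conorm (deriv_at f x) \<le> onorm (deriv_at f x)"
    and "onorm (inv (deriv_at f x)) = 1 / conorm (deriv_at f x)"
proof -
  let ?g = "inv_into A f" and ?A = "deriv_at f x"
  have inj: "inj_on f A" and op: "open (f ` A)"
    using f by (auto simp: C1_diffeo_onto_open_def)
  obtain A' where "(f has_derivative A') (at x)"
    using f x unfolding C1_diffeo_onto_open_def C1_on_def by blast
  then show A': "(f has_derivative ?A) (at x)"
    using frechet_derivative_at by metis
  obtain B where B: "(?g has_derivative B) (at (f x))"
    using f x unfolding C1_diffeo_onto_open_def C1_on_def by blast
  have "(?g \<circ> f has_derivative B \<circ> ?A) (at x)"
    by (rule diff_chain_at[OF A' B])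
  moreover have "(?g \<circ> f has_derivative id) (at x)"
    by (rule has_derivative_transform_within_open[OF has_derivative_id A x]) (use inj in auto)
  ultimately have BA: "B \<circ> ?A = id" using has_derivative_unique by blast
  have "(f \<circ> ?g has_derivative ?A \<circ> B) (at (f x))"
    by (rule diff_chain_at[OF B]) (use A' inj x in auto)
  moreover have "(f \<circ> ?g has_derivative id) (at (f x))"
    by (rule has_derivative_transform_within_open[OF has_derivative_id op])
      (use x in \<open>auto simp: f_inv_into_f\<close>)
  ultimately have AB: "?A \<circ> B = id" using has_derivative_unique by blast
  have inv: "inv ?A = B" using AB BA by (rule inv_unique_comp)
  with B show "(?g has_derivative inv ?A) (at (f x))" by simp
  have bA: "bounded_linear ?A" and bB: "bounded_linear B"
    using A' B has_derivative_bounded_linear by auto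
  obtain h :: 'a where h: "h \<noteq> 0" using nonzero_Basis SOME_Basis by blast
  have "B (?A h) = h" "?A (B h) = h" using AB BA by (metis comp_apply id_apply)+
  then have "B (?A h) \<noteq> 0" using h by simp
  then have pos: "0 < onorm B" using onorm_pos_lt[OF bB] by blast
  then show "0 < conorm ?A" by (simp add: conorm_def inv)
  show "onorm (inv ?A) = 1 / conorm ?A" by (simp add: conorm_def field_simps)
  have "norm h \<le> onorm ?A * (onorm B * norm h)"
    using onorm[OF bA, of "B h"] mult_left_mono[OF onorm[OF bB, of h] onorm_pos_le[OF bA]]
    by (simp add: \<open>?A (B h) = h\<close>)
  then have "norm h * 1 \<le> norm h * (onorm ?A * onorm B)" by (simp add: mult_ac)
  then have "1 \<le> onorm ?A * onorm B" using h by (subst (asm) mult_le_cancel_left_pos) auto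
  then show "conorm ?A \<le> onorm ?A"
    using pos by (simp add: conorm_def inv field_simps)
qed

text \<open>The domain of \<open>f\<close> need not be convex and neither is its image, so the lower bound cannot come
  from integrating along a segment between \<open>f x\<close> and \<open>f y\<close> in the image. Follow this
  segment only until it leaves the image of the ball. Up to that exit point the inverse map is
  defined and \<open>1/c\<close>-Lipschitz, and it moves by exactly the radius \<open>\<rho>\<close>.\<close>

lemma C1_diffeo_expands_outside_ball:
  fixes f :: "'a::euclidean_space \<Rightarrow> 'a"
  assumes f: "C1_diffeo_onto_open U f" and U: "open U"
    and ball: "cball x \<rho> \<subseteq> U" and \<rho>: "0 < \<rho>" and y: "y \<in> U" "\<rho> \<le> dist x y"
    and c: "0 < c" and conorm: "\<And>z. z \<in> cball x \<rho> \<Longrightarrow> c \<le> conorm (deriv_at f z)"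
  shows "c * \<rho> \<le> dist (f x) (f y)"
proof -
  let ?g = "inv_into U f" and ?S = "f ` ball x \<rho>" and ?l = "linepath (f x) (f y)"
  have inj: "inj_on f U" using f by (simp add: C1_diffeo_onto_open_def)
  have xU: "x \<in> U" and bU: "ball x \<rho> \<subseteq> U" using ball \<rho> by auto
  have cont: "continuous_on U f"
    using C1_diffeo_derivative(1)[OF f U] U
    by (auto simp: continuous_on_eq_continuous_at intro: has_derivative_continuous)
  have S: "open ?S"
    by (intro invariance_of_domain continuous_on_subset[OF cont bU] inj_on_subset[OF inj bU]) auto
  have fy: "f y \<notin> ?S" using inj y bU by (auto dest: inj_onD)
  \<comment> \<open>the exit point of the segment from the image of the ball\<close>
  obtain u where u: "0 \<le> u" "u \<le> 1" "?l u \<in> frontier ?S"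
      "path_image (subpath 0 u ?l) - {?l u} \<subseteq> interior ?S"
    using subpath_to_frontier[of ?l ?S] fy closure_subset[of ?S] \<rho> by force
  have cl: "closed (f ` cball x \<rho>)"
    by (intro compact_imp_closed compact_continuous_image continuous_on_subset[OF cont ball]) auto
  have "closure ?S \<subseteq> f ` cball x \<rho>"
    by (intro closure_minimal cl image_mono) auto
  then obtain z where z: "?l u = f z" "z \<in> cball x \<rho>" using u(3) by (auto simp: frontier_def)
  have "f z \<notin> ?S" using u(3) S z by (metis frontier_disjoint_eq disjoint_iff)
  then have zx: "dist x z = \<rho>" using z by auto
  have seg: "closed_segment (f x) (f z) \<subseteq> f ` cball x \<rho>"
  proof
    fix w assume "w \<in> closed_segment (f x) (f z)"
    then obtain s where s: "0 \<le> s" "s \<le> 1" "w = (1 - s) *\<^sub>R f x + s *\<^sub>R ?l u"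
      using z by (auto simp: in_segment)
    then have "w = ?l (s * u)" by (simp add: linepath_def algebra_simps)
    moreover have "s * u \<in> {0..u}" using s u by (auto simp: mult_left_le_one_le)
    ultimately have "w \<in> path_image (subpath 0 u ?l)" using u by (auto simp: path_image_subpath)
    then have "w = f z \<or> w \<in> ?S" using u(4) interior_subset[of ?S] z by auto
    then show "w \<in> f ` cball x \<rho>" using z by auto
  qed
  have "norm (?g (f x) - ?g (f z)) \<le> 1 / c * norm (f x - f z)"
  proof (rule differentiable_bound)
    fix w assume "w \<in> closed_segment (f x) (f z)"
    then obtain v where v: "v \<in> cball x \<rho>" "w = f v" using seg by auto
    then have vU: "v \<in> U" using ball by auto
    then have gw: "?g w = v" using v inj by simp
    show "(?g has_derivative inv (deriv_at f (?g w))) (at w within closed_segment (f x) (f z))"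
      using C1_diffeo_derivative(2)[OF f U vU] v(2) gw by (auto intro: has_derivative_at_withinI)
    show "onorm (inv (deriv_at f (?g w))) \<le> 1 / c"
      using C1_diffeo_derivative(5)[OF f U vU] conorm[OF v(1)] c gw
      by (auto intro!: divide_left_mono)
  qed auto
  then have "\<rho> \<le> 1 / c * dist (f x) (f z)"
    using z zx xU ball inj by (auto simp: dist_norm)
  then have "c * \<rho> \<le> dist (f x) (f z)" using c by (simp add: field_simps)
  also have "f x - f z = u *\<^sub>R (f x - f y)" unfolding z(1)[symmetric] by (simp add: linepath_def algebra_simps)
  then have "dist (f x) (f z) = u * dist (f x) (f y)" using u by (simp add: dist_norm)
  also have "\<dots> \<le> dist (f x) (f y)" using u by (simp add: mult_left_le_one_le)
  finally show ?thesis .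
qed

text \<open>Lebesgue measure replaces counting the links of a chain of overlapping sets.\<close>

lemma interval_length_le_of_finite_cover:
  fixes S :: "'p \<Rightarrow> real set" and R \<epsilon> :: real
  assumes "finite P" and cov: "{0..R} \<subseteq> (\<Union>p\<in>P. S p)" and \<epsilon>: "0 \<le> \<epsilon>"
    and S: "\<And>p a b. a \<in> S p \<Longrightarrow> b \<in> S p \<Longrightarrow> \<bar>a - b\<bar> \<le> \<epsilon>"
  shows "R \<le> card P * (2 * \<epsilon>)"
proof (cases "0 \<le> R")
  case True
  define I where "I p = cbox ((SOME a. a \<in> S p) - \<epsilon>) ((SOME a. a \<in> S p) + \<epsilon>)" for p
  have "S p \<subseteq> I p" for p
  proof
    fix b assume b: "b \<in> S p"
    then have "(SOME a. a \<in> S p) \<in> S p" by (rule someI)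
    from S[OF this b] show "b \<in> I p" by (auto simp: I_def)
  qed
  then have "(\<Union>p\<in>P. S p) \<subseteq> (\<Union>p\<in>P. I p)" by (intro UN_mono) auto
  with cov have "cbox 0 R \<subseteq> (\<Union>p\<in>P. I p)" by simp
  then have "measure lborel (cbox 0 R) \<le> measure lborel (\<Union>p\<in>P. I p)"
    using assms(1) fmeasurable_cbox[where ?'a=real]
    by (intro measure_mono_fmeasurable fmeasurable.finite_UN) (auto simp: I_def simp del: cbox_interval)
  also have "\<dots> \<le> (\<Sum>p\<in>P. measure lborel (I p))"
    by (rule measure_UNION_le[OF assms(1)]) (auto simp: I_def)
  also have "\<dots> = (\<Sum>p\<in>P. 2 * \<epsilon>)"
    using \<epsilon> by (intro sum.cong) (auto simp: I_def)
  finally show ?thesis using True by simp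
next
  case False
  then show ?thesis using \<epsilon> mult_nonneg_nonneg[of "real (card P)" "2 * \<epsilon>"] by linarith
qed

text \<open>The sets \<open>J\<close> are connected but not convex, so a derivative bound on \<open>U\<close> controls \<open>g\<close> only
  locally. Cover \<open>J\<close> by a number of balls that depends only on \<open>D\<close> and \<open>\<delta>\<close>; on each piece, \<open>g\<close>
  oscillates by at most \<open>\<delta>\<rho>\<close>. The distance to \<open>g x\<close> maps \<open>J\<close> onto an interval, which is covered
  by as many short pieces. The constant does not depend on \<open>J\<close>, \<open>U\<close> and \<open>g\<close>, hence serves all of
  the infinitely many vertices.\<close>

lemma connected_image_diameter_bound:
  fixes D \<delta> :: real
  assumes \<delta>: "0 < \<delta>"
  obtains M where "0 < M"
    and "\<And>J U (g :: 'a::euclidean_space \<Rightarrow> 'a) \<rho> x y.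
      connected J \<Longrightarrow> (\<And>x y. x \<in> J \<Longrightarrow> y \<in> J \<Longrightarrow> dist x y \<le> D) \<Longrightarrow>
      (\<And>x. x \<in> J \<Longrightarrow> ball x \<delta> \<subseteq> U) \<Longrightarrow> 0 \<le> \<rho> \<Longrightarrow>
      (\<And>x. x \<in> U \<Longrightarrow> \<exists>g'. (g has_derivative g') (at x) \<and> onorm g' \<le> \<rho>) \<Longrightarrow>
      x \<in> J \<Longrightarrow> y \<in> J \<Longrightarrow> dist (g x) (g y) \<le> M * \<rho>"
proof -
  have "cball (0::'a) D \<subseteq> (\<Union>p\<in>cball 0 D. ball p (\<delta> / 2))" using \<delta> by force
  then obtain P where P: "finite P" "cball (0::'a) D \<subseteq> (\<Union>p\<in>P. ball p (\<delta> / 2))"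
    using compactE_image[OF compact_cball[of "0::'a" D], of "cball 0 D" "\<lambda>p. ball p (\<delta>/2)"]
    by (metis open_ball)
  show ?thesis
  proof (rule that[of "real (card P) * (2 * \<delta>) + 1"])
    show "0 < real (card P) * (2 * \<delta>) + 1" using \<delta> by (simp add: add_nonneg_pos)
  next
    fix J U :: "'a set" and g :: "'a \<Rightarrow> 'a" and \<rho> x y
    assume J: "connected J" and D: "\<And>x y. x \<in> J \<Longrightarrow> y \<in> J \<Longrightarrow> dist x y \<le> D"
      and U: "\<And>x. x \<in> J \<Longrightarrow> ball x \<delta> \<subseteq> U" and \<rho>: "0 \<le> \<rho>"
      and g: "\<And>x. x \<in> U \<Longrightarrow> \<exists>g'. (g has_derivative g') (at x) \<and> onorm g' \<le> \<rho>"
      and x: "x \<in> J" and y: "y \<in> J"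
    obtain g' where g': "\<And>x. x \<in> U \<Longrightarrow> (g has_derivative g' x) (at x)" "\<And>x. x \<in> U \<Longrightarrow> onorm (g' x) \<le> \<rho>"
      using g by metis
    have JU: "J \<subseteq> U" using U \<delta> by force
    define h where "h z = dist (g x) (g z)" for z
    define Jp where "Jp p = J \<inter> ball (x + p) (\<delta> / 2)" for p
    have Jcov: "J \<subseteq> (\<Union>p\<in>P. Jp p)"
    proof
      fix z assume z: "z \<in> J"
      then have "z - x \<in> cball 0 D" using D[OF x z] by (simp add: dist_norm norm_minus_commute)
      then obtain p where "p \<in> P" "z - x \<in> ball p (\<delta> / 2)" using P by auto
      then show "z \<in> (\<Union>p\<in>P. Jp p)" using z by (auto simp: Jp_def dist_norm algebra_simps)
    qed
    have close: "\<bar>h a - h b\<bar> \<le> \<delta> * \<rho>" if "a \<in> Jp p" "b \<in> Jp p" for a b p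
    proof -
      have ab: "dist a b < \<delta>" using that dist_triangle_half_l[of a "x+p" \<delta> b] 
        by (auto simp: Jp_def dist_commute)
      have sub: "ball a \<delta> \<subseteq> U" using that U by (auto simp: Jp_def)
      have "norm (g a - g b) \<le> \<rho> * norm (a - b)"
        by (rule differentiable_bound[of "ball a \<delta>" g g'])
          (use g' sub ab \<delta> in \<open>auto intro!: has_derivative_at_withinI g'(1)\<close>)
      also have "\<dots> \<le> \<rho> * \<delta>" using ab \<rho> by (intro mult_left_mono) (auto simp: dist_norm)
      finally have "dist (g a) (g b) \<le> \<delta> * \<rho>" by (simp add: dist_norm mult.commute)
      moreover have "\<bar>h a - h b\<bar> \<le> dist (g a) (g b)"
        unfolding h_def by (metis abs_dist_diff_le dist_commute)
      ultimately show ?thesis by simp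
    qed
    have "continuous_on J g"
      unfolding continuous_on_eq_continuous_within
      using JU has_derivative_continuous[OF g'(1)]
      by (meson continuous_at_imp_continuous_within subsetD)
    then have conn: "connected (h ` J)"
      unfolding h_def by (intro connected_continuous_image J continuous_intros)
    have "h x = 0" by (simp add: h_def)
    with imageI[OF x, of h] have "0 \<in> h ` J" by simp
    from connected_contains_Icc[OF conn this imageI[OF y]] have "{0..h y} \<subseteq> h ` J" .
    moreover have "h ` J \<subseteq> (\<Union>p\<in>P. h ` Jp p)"
      using image_mono[OF Jcov, of h] by (simp only: image_UN)
    ultimately have "{0..h y} \<subseteq> (\<Union>p\<in>P. h ` Jp p)" by (rule order_trans)
    then have "h y \<le> card P * (2 * (\<delta> * \<rho>))"
    proof (rule interval_length_le_of_finite_cover[OF P(1)])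
      show "0 \<le> \<delta> * \<rho>" using \<delta> \<rho> by simp
      show "\<bar>s - s'\<bar> \<le> \<delta> * \<rho>" if "s \<in> h ` Jp p" "s' \<in> h ` Jp p" for s s' p
        using that close by blast
    qed
    then show "dist (g x) (g y) \<le> (real (card P) * (2 * \<delta>) + 1) * \<rho>"
      using \<rho> by (simp add: h_def algebra_simps)
  qed
qed

section \<open>Coding, distances and distortion\<close>

lemma shift_funpow: "(shift ^^ k) \<omega> = (\<lambda>n. \<omega> (n + k))"
  by (induction k arbitrary: \<omega>) (auto simp: shift_def fun_eq_iff)

lemma path_space_shift: "\<omega> \<in> path_space G \<Longrightarrow> shift \<omega> \<in> path_space G"
  by (auto simp: path_space_def shift_def)

lemma path_space_funpow: "\<omega> \<in> path_space G \<Longrightarrow> (shift ^^ k) \<omega> \<in> path_space G"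
  by (induction k) (auto simp: path_space_shift)

lemma path_map_Suc_shift:
  "path_map G T \<omega> (Suc k) = T (edge G (\<omega> 0) (\<omega> 1)) \<circ> path_map G T (shift \<omega>) k"
proof (induction k)
  case (Suc k)
  show ?case
    by (subst path_map.simps(2), subst Suc) (simp only: path_map.simps(2) shift_def o_assoc)
qed (simp add: shift_def)

text \<open>The hypotheses enter through explicit constants: \<open>r\<close> is the contraction ratio, \<open>\<delta>\<close> the width of
  a collar around every \<open>J v\<close> inside \<open>U v\<close>, \<open>c\<close> and \<open>\<beta>\<close> are distortion constants of the inverse maps, and
  \<open>M\<close> comes from \<open>connected_image_diameter_bound\<close>. Distortion is stated with an exponential, the form that
  is multiplied along an orbit.\<close>

locale distorted_gifs = simple_gifs G J U T
  for G :: "('v, 'e) pre_digraph" (structure)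
    and J U :: "'v \<Rightarrow> (real ^ 'n) set"
    and T :: "'e \<Rightarrow> real ^ 'n \<Rightarrow> real ^ 'n" +
  fixes r \<delta> c \<beta> M :: real
  assumes r: "0 < r" "r < 1"
    and onorm_le: "\<And>e x. e \<in> arcs G \<Longrightarrow> x \<in> U (head G e) \<Longrightarrow> onorm (deriv_at (T e) x) \<le> r"
    and \<delta>: "0 < \<delta>" and cball_subset: "\<And>v x. v \<in> verts G \<Longrightarrow> x \<in> J v \<Longrightarrow> cball x \<delta> \<subseteq> U v"
    and c: "0 < c" and \<beta>: "0 < \<beta>"
    and distortion: "\<And>e x y. e \<in> arcs G \<Longrightarrow> x \<in> U (head G e) \<Longrightarrow> y \<in> U (head G e) \<Longrightarrow>
      conorm (deriv_at (T e) y) \<le> conorm (deriv_at (T e) x) * exp (c * dist x y powr \<beta>)"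
    and M: "0 < M"
    and image_diameter: "\<And>v (g :: real ^ 'n \<Rightarrow> real ^ 'n) \<rho> x y. v \<in> verts G \<Longrightarrow> 0 \<le> \<rho> \<Longrightarrow>
      (\<And>x. x \<in> U v \<Longrightarrow> \<exists>g'. (g has_derivative g') (at x) \<and> onorm g' \<le> \<rho>) \<Longrightarrow>
      x \<in> J v \<Longrightarrow> y \<in> J v \<Longrightarrow> dist (g x) (g y) \<le> M * \<rho>"
    and separation: "strong_separation G J T"
begin

abbreviation "X \<equiv> path_space G"
abbreviation "\<pi> \<equiv> coding_map G J T"
abbreviation "\<phi> \<equiv> lower_potential G J T"
abbreviation "S n \<omega> \<equiv> (\<Sum>i<n. \<phi> ((shift ^^ i) \<omega>))"

lemma edge_props:
  assumes "(v, u) \<in> arcs_ends G"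
  shows "edge G v u \<in> arcs G" "tail G (edge G v u) = v" "head G (edge G v u) = u"
proof -
  obtain e where e: "e \<in> arcs G \<and> tail G e = v \<and> head G e = u"
    using assms by (auto simp: arcs_ends_conv)
  then have "\<exists>!e. e \<in> arcs G \<and> tail G e = v \<and> head G e = u"
    using no_multi_arcs by (auto simp: arc_to_ends_def)
  from theI'[OF this] show "edge G v u \<in> arcs G" "tail G (edge G v u) = v" "head G (edge G v u) = u"
    by (auto simp: edge_def)
qed

lemma path_edge:
  assumes "\<omega> \<in> X"
  shows "edge G (\<omega> k) (\<omega> (Suc k)) \<in> arcs G"
    and "tail G (edge G (\<omega> k) (\<omega> (Suc k))) = \<omega> k"
    and "head G (edge G (\<omega> k) (\<omega> (Suc k))) = \<omega> (Suc k)"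
  using assms by (auto simp: path_space_def intro: edge_props)

lemma path_vert: "\<omega> \<in> X \<Longrightarrow> \<omega> k \<in> verts G"
  by (auto simp: path_space_def)

lemma J_subset_U: "v \<in> verts G \<Longrightarrow> J v \<subseteq> U v"
  using cball_subset \<delta> by force

lemma T_has_derivative:
  assumes "e \<in> arcs G" "x \<in> U (head G e)"
  shows "(T e has_derivative deriv_at (T e) x) (at x)"
  using C1_diffeo_derivative(1)[OF T_diffeo[OF assms(1)] _ assms(2)] U_set assms by auto

lemma conorm_pos:
  assumes "e \<in> arcs G" "x \<in> U (head G e)"
  shows "0 < conorm (deriv_at (T e) x)"
  using C1_diffeo_derivative(3)[OF T_diffeo[OF assms(1)] _ assms(2)] U_set assms by auto

lemma conorm_le:
  assumes "e \<in> arcs G" "x \<in> U (head G e)"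
  shows "conorm (deriv_at (T e) x) \<le> r"
  using C1_diffeo_derivative(4)[OF T_diffeo[OF assms(1)] _ assms(2)] U_set onorm_le assms
  by (meson head_in_verts order_trans)

lemma path_map_derivative:
  assumes "\<omega> \<in> X"
  shows "x \<in> U (\<omega> (Suc k)) \<Longrightarrow>
    \<exists>g'. (path_map G T \<omega> k has_derivative g') (at x) \<and> onorm g' \<le> r ^ Suc k"
proof (induction k arbitrary: x)
  case 0
  note e = path_edge[OF assms, of 0]
  have x: "x \<in> U (head G (edge G (\<omega> 0) (\<omega> (Suc 0))))" using 0 e by simp
  show ?case
    using T_has_derivative[OF e(1) x] onorm_le[OF e(1) x] by (intro exI conjI) simp_all
next
  case (Suc k)
  let ?e = "edge G (\<omega> (Suc k)) (\<omega> (Suc (Suc k)))"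
  note e = path_edge[OF assms, of "Suc k"]
  have x: "x \<in> U (head G ?e)" using Suc e by simp
  then have "T ?e x \<in> U (\<omega> (Suc k))" using T_U[OF e(1)] e by auto
  from Suc.IH[OF this] obtain g' where g': "(path_map G T \<omega> k has_derivative g') (at (T ?e x))"
    "onorm g' \<le> r ^ Suc k" by blast
  have *: "(path_map G T \<omega> (Suc k) has_derivative g' \<circ> deriv_at (T ?e) x) (at x)"
    using diff_chain_at[OF T_has_derivative[OF e(1) x] g'(1)] by simp
  have "onorm (g' \<circ> deriv_at (T ?e) x) \<le> onorm g' * onorm (deriv_at (T ?e) x)"
    by (intro onorm_compose has_derivative_bounded_linear[OF g'(1)]
        has_derivative_bounded_linear[OF T_has_derivative[OF e(1) x]])
  also have "\<dots> \<le> r ^ Suc k * r"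
    using g' onorm_le[OF e(1) x] r onorm_pos_le[OF has_derivative_bounded_linear[OF g'(1)]]
      onorm_pos_le[OF has_derivative_bounded_linear[OF T_has_derivative[OF e(1) x]]]
    by (intro mult_mono) auto
  also have "\<dots> = r ^ Suc (Suc k)" by simp
  finally show ?case using * by blast
qed

lemma path_map_image_antimono:
  assumes "\<omega> \<in> X"
  shows "path_map G T \<omega> (Suc k) ` J (\<omega> (Suc (Suc k))) \<subseteq> path_map G T \<omega> k ` J (\<omega> (Suc k))"
  using T_J[OF path_edge(1)[OF assms, of "Suc k"]] path_edge[OF assms, of "Suc k"]
  by (auto simp: image_comp[symmetric])

lemma path_map_image_diameter:
  assumes "\<omega> \<in> X" "a \<in> path_map G T \<omega> k ` J (\<omega> (Suc k))" "b \<in> path_map G T \<omega> k ` J (\<omega> (Suc k))"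
  shows "dist a b \<le> M * r ^ Suc k"
  using assms(2,3) image_diameter[OF path_vert[OF assms(1)] _ path_map_derivative[OF assms(1)]] r
  by auto

text \<open>The nested compact sets shrink to a point at a rate that is uniform over all paths; this makes the
  definite description in the definition of the coding map meaningful.\<close>

lemma coding_map_eq:
  assumes "\<omega> \<in> X"
  shows "{\<pi> \<omega>} = (\<Inter>k. path_map G T \<omega> k ` J (\<omega> (Suc k)))"
proof -
  let ?A = "\<lambda>k. path_map G T \<omega> k ` J (\<omega> (Suc k))"
  have "\<exists>a. \<Inter> (range ?A) = {a}"
  proof (rule decreasing_closed_nest_sing)
    fix k
    have "continuous_on (J (\<omega> (Suc k))) (path_map G T \<omega> k)"
      unfolding continuous_on_eq_continuous_within
      using path_map_derivative[OF assms] J_subset_U[OF path_vert[OF assms]]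
      by (meson continuous_at_imp_continuous_within has_derivative_continuous subsetD)
    then show "closed (?A k)"
      using J_set[OF path_vert[OF assms]] by (intro compact_imp_closed compact_continuous_image) auto
    show "?A k \<noteq> {}" using J_set[OF path_vert[OF assms]] by auto
  next
    fix m n :: nat assume "m \<le> n"
    then show "?A n \<subseteq> ?A m"
      by (rule lift_Suc_antimono_le[where f = ?A, rotated]) (rule path_map_image_antimono[OF assms])
  next
    fix \<epsilon> :: real assume "0 < \<epsilon>"
    then obtain n where n: "r ^ n < \<epsilon> / M" using real_arch_pow_inv[of "\<epsilon> / M" r] r M by auto
    have "M * r ^ Suc n \<le> M * r ^ n" using M r by (simp add: mult_left_le_one_le)
    also have "\<dots> < \<epsilon>" using n M by (simp add: field_simps)
    finally have "M * r ^ Suc n < \<epsilon>" .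
    with path_map_image_diameter[OF assms, of _ n] show "\<exists>n. \<forall>x\<in>?A n. \<forall>y\<in>?A n. dist x y < \<epsilon>"
      by (meson order.strict_trans1)
  qed
  then have "\<exists>!x. {x} = \<Inter> (range ?A)" by (metis singleton_inject)
  from theI'[OF this] show ?thesis by (simp add: coding_map_def)
qed

lemma coding_map_in_image:
  assumes "\<omega> \<in> X"
  shows "\<pi> \<omega> \<in> path_map G T \<omega> k ` J (\<omega> (Suc k))"
  using coding_map_eq[OF assms] by blast

lemma coding_map_in_J:
  assumes "\<omega> \<in> X"
  shows "\<pi> \<omega> \<in> J (\<omega> 0)"
  using coding_map_in_image[OF assms, of 0] T_J[OF path_edge(1)[OF assms, of 0]]
    path_edge[OF assms, of 0] by auto

lemma coding_map_shift_in_U: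
  assumes "\<omega> \<in> X"
  shows "\<pi> (shift \<omega>) \<in> U (head G (edge G (\<omega> 0) (\<omega> 1)))"
  using coding_map_in_J[OF path_space_shift[OF assms]] J_subset_U[OF path_vert[OF assms, of 1]]
    path_edge(3)[OF assms, of 0] by (auto simp: shift_def)

lemma coding_map_shift:
  assumes "\<omega> \<in> X"
  shows "\<pi> \<omega> = T (edge G (\<omega> 0) (\<omega> 1)) (\<pi> (shift \<omega>))"
proof -
  let ?x = "T (edge G (\<omega> 0) (\<omega> 1)) (\<pi> (shift \<omega>))"
  note \<omega>' = path_space_shift[OF assms]
  have "?x \<in> path_map G T \<omega> k ` J (\<omega> (Suc k))" for k
  proof (cases k)
    case 0
    then show ?thesis using coding_map_in_J[OF \<omega>'] by (auto simp: shift_def)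
  next
    case (Suc m)
    have "path_map G T \<omega> k ` J (\<omega> (Suc k)) =
      T (edge G (\<omega> 0) (\<omega> 1)) ` (path_map G T (shift \<omega>) m ` J (shift \<omega> (Suc m)))"
      unfolding Suc path_map_Suc_shift by (simp add: image_comp shift_def)
    then show ?thesis using coding_map_in_image[OF \<omega>', of m] by auto
  qed
  then have "?x \<in> {\<pi> \<omega>}" unfolding coding_map_eq[OF assms] by blast
  then show ?thesis by simp
qed

lemma path_map_cong:
  assumes "\<And>j. j \<le> Suc k \<Longrightarrow> \<omega> j = \<omega>' j"
  shows "path_map G T \<omega> k = path_map G T \<omega>' k"
  using assms by (induction k) auto

lemma dist_coding_map_le:
  assumes "\<omega> \<in> X" "\<omega>' \<in> X" "\<And>j. j \<le> n \<Longrightarrow> \<omega> j = \<omega>' j"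
  shows "dist (\<pi> \<omega>) (\<pi> \<omega>') \<le> M * r ^ n"
proof (cases n)
  case 0
  have "\<exists>g'. (id has_derivative g') (at x) \<and> onorm g' \<le> 1" for x :: "real ^ 'n"
    by (intro exI[of _ id] conjI has_derivative_id onorm_bound) auto
  moreover have "\<pi> \<omega> \<in> J (\<omega> 0)" "\<pi> \<omega>' \<in> J (\<omega> 0)"
    using coding_map_in_J[OF assms(1)] coding_map_in_J[OF assms(2)] assms(3)[of 0] by auto
  ultimately have "dist (id (\<pi> \<omega>)) (id (\<pi> \<omega>')) \<le> M * 1"
    by (intro image_diameter[OF path_vert[OF assms(1), of 0]]) (blast intro: zero_le_one)+
  then show ?thesis using 0 by simp
next
  case (Suc k)
  then have "path_map G T \<omega>' k = path_map G T \<omega> k" "\<omega>' (Suc k) = \<omega> (Suc k)"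
    using assms(3) by (auto intro: path_map_cong)
  then show ?thesis
    using path_map_image_diameter[OF assms(1) coding_map_in_image[OF assms(1)]]
      coding_map_in_image[OF assms(2), of k] Suc by metis
qed

lemma coding_map_in_limit_set: "\<omega> \<in> X \<Longrightarrow> \<pi> \<omega> \<in> limit_set G J T"
  by (auto simp: limit_set_def)

text \<open>Strong separation compares any two edges, whatever their initial vertices; so a point of the
  limit set determines the first edge of each of its codes.\<close>

lemma coding_map_inj_step:
  assumes "\<omega> \<in> X" "\<omega>' \<in> X" "\<pi> \<omega> = \<pi> \<omega>'"
  shows "\<omega> 0 = \<omega>' 0 \<and> \<pi> (shift \<omega>) = \<pi> (shift \<omega>')"
proof -
  let ?e = "edge G (\<omega> 0) (\<omega> 1)" and ?e' = "edge G (\<omega>' 0) (\<omega>' 1)"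
  have e: "?e \<in> arcs G" "?e' \<in> arcs G" using path_edge(1)[of _ 0] assms by auto
  have mem: "\<pi> \<eta> \<in> T (edge G (\<eta> 0) (\<eta> 1)) `
      (J (head G (edge G (\<eta> 0) (\<eta> 1))) \<inter> limit_set G J T)" if "\<eta> \<in> X" for \<eta>
  proof -
    have "\<pi> (shift \<eta>) \<in> J (head G (edge G (\<eta> 0) (\<eta> 1))) \<inter> limit_set G J T"
      using coding_map_in_J[OF path_space_shift[OF that]] path_edge(3)[OF that, of 0]
        coding_map_in_limit_set[OF path_space_shift[OF that]] by (simp add: shift_def)
    with coding_map_shift[OF that] show ?thesis by (intro image_eqI)
  qed
  have ee: "?e = ?e'"
  proof (rule ccontr)
    assume "?e \<noteq> ?e'"
    then have "T ?e ` (J (head G ?e) \<inter> limit_set G J T) \<inter> T ?e' ` (J (head G ?e') \<inter> limit_set G J T) = {}"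
      using separation e by (simp add: strong_separation_def)
    with mem[OF assms(1)] mem[OF assms(2)] assms(3) show False by (simp add: disjoint_iff)
  qed
  have inj: "inj_on (T ?e) (U (head G ?e))"
    using T_diffeo[OF e(1)] by (simp add: C1_diffeo_onto_open_def)
  have "T ?e (\<pi> (shift \<omega>)) = T ?e (\<pi> (shift \<omega>'))"
    using coding_map_shift[OF assms(1)] coding_map_shift[OF assms(2)] assms(3) ee by simp
  then have "\<pi> (shift \<omega>) = \<pi> (shift \<omega>')"
    using coding_map_shift_in_U[OF assms(1)] coding_map_shift_in_U[OF assms(2)] inj ee
    by (auto dest: inj_onD)
  moreover have "\<omega> 0 = \<omega>' 0" using ee path_edge(2)[of _ 0] assms(1,2) by (metis One_nat_def)
  ultimately show ?thesis by simp
qed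

lemma coding_map_inj:
  assumes "\<omega> \<in> X" "\<omega>' \<in> X" "\<pi> \<omega> = \<pi> \<omega>'"
  shows "\<omega> = \<omega>'"
proof
  fix n
  have "\<pi> ((shift ^^ n) \<omega>) = \<pi> ((shift ^^ n) \<omega>')"
  proof (induction n)
    case (Suc n)
    then show ?case
      using coding_map_inj_step[OF path_space_funpow[OF assms(1)] path_space_funpow[OF assms(2)]]
      by simp
  qed (simp add: assms)
  then have "(shift ^^ n) \<omega> 0 = (shift ^^ n) \<omega>' 0"
    using coding_map_inj_step assms path_space_funpow by blast
  then show "\<omega> n = \<omega>' n" by (simp add: shift_funpow)
qed

lemma exp_potential:
  assumes "\<omega> \<in> X"
  shows "exp (\<phi> \<omega>) = conorm (deriv_at (T (edge G (\<omega> 0) (\<omega> 1))) (\<pi> (shift \<omega>)))"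
  using conorm_pos[OF path_edge(1)[OF assms, of 0]] coding_map_shift_in_U[OF assms]
  by (simp add: lower_potential_def)

lemma potential_le:
  assumes "\<omega> \<in> X"
  shows "\<phi> \<omega> \<le> ln r"
proof -
  have "exp (\<phi> \<omega>) \<le> r"
    using conorm_le[OF path_edge(1)[OF assms, of 0]] coding_map_shift_in_U[OF assms]
    by (simp add: exp_potential[OF assms])
  then show ?thesis using r by (simp add: ln_ge_iff)
qed

lemma birkhoff_Suc: "S (Suc n) \<omega> = \<phi> \<omega> + S n (shift \<omega>)"
  by (subst sum.lessThan_Suc_shift) (simp add: shift_funpow shift_def)

lemma birkhoff_add: "S (m + n) \<omega> = S m \<omega> + S n ((shift ^^ m) \<omega>)"
  by (induction n) (simp_all add: shift_funpow add_ac)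

lemma birkhoff_le:
  assumes "\<omega> \<in> X"
  shows "S n \<omega> \<le> n * ln r"
  using sum_bounded_above[of "{..<n}" "\<lambda>i. \<phi> ((shift ^^ i) \<omega>)" "ln r"]
    potential_le path_space_funpow[OF assms] by simp

lemma exp_birkhoff_le:
  assumes "\<omega> \<in> X"
  shows "exp (S n \<omega>) \<le> r ^ n"
proof -
  have "exp (S n \<omega>) \<le> exp (n * ln r)" using birkhoff_le[OF assms] by simp
  also have "\<dots> = r ^ n" using r by (simp add: exp_of_nat_mult)
  finally show ?thesis .
qed

definition distortion_const :: "real \<Rightarrow> real" where
  "distortion_const a = c * a powr \<beta> / (1 - r powr \<beta>)"

text \<open>Applying \<open>i\<close> of the contractions to points at distance \<open>a\<close> brings them to distance at most \<open>a r\<^sup>i\<close>, so the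
  distortion errors along an orbit form a geometric series.\<close>

lemma distortion_sum_le:
  assumes "0 < a"
  shows "(\<Sum>i<n. c * (a * r ^ i) powr \<beta>) \<le> distortion_const a"
proof -
  have q: "0 < r powr \<beta>" "r powr \<beta> < 1" using r \<beta> powr_less_mono2[of \<beta> r 1] by auto
  have "(a * r ^ i) powr \<beta> = a powr \<beta> * (r powr \<beta>) ^ i" for i
    using r assms by (simp add: powr_mult powr_powr powr_realpow[symmetric] mult.commute)
  then have "(\<Sum>i<n. c * (a * r ^ i) powr \<beta>) = c * a powr \<beta> * (\<Sum>i<n. (r powr \<beta>) ^ i)"
    by (simp add: sum_distrib_left mult.assoc)
  also have "\<dots> \<le> c * a powr \<beta> * (1 / (1 - r powr \<beta>))"
    using q c by (intro mult_left_mono) (auto simp: sum_gp_strict divide_right_mono)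
  finally show ?thesis by (simp add: distortion_const_def)
qed

text \<open>Agreement up to and including the index \<open>n\<close> is what is needed: the last term of the sum
  depends on the vertex \<open>\<omega> n\<close> and on a point of its set \<open>J\<close>.\<close>

lemma birkhoff_distortion:
  assumes "\<omega> \<in> X" "\<omega>' \<in> X" "\<And>j. j \<le> n \<Longrightarrow> \<omega> j = \<omega>' j"
  shows "S n \<omega>' \<le> S n \<omega> + distortion_const M"
proof -
  have "S n \<omega>' \<le> S n \<omega> + (\<Sum>i<n. c * (M * r ^ i) powr \<beta>)"
    using assms
  proof (induction n arbitrary: \<omega> \<omega>')
    case (Suc n)
    let ?e = "edge G (\<omega> 0) (\<omega> 1)"
    let ?D = "c * (M * r ^ n) powr \<beta>"
    have e: "edge G (\<omega>' 0) (\<omega>' 1) = ?e"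
      using Suc.prems(3)[of 0] Suc.prems(3)[of 1] by (simp only: zero_le One_nat_def Suc_le_mono)
    note sh = path_space_shift[OF Suc.prems(1)] path_space_shift[OF Suc.prems(2)]
    have agree: "shift \<omega> j = shift \<omega>' j" if "j \<le> n" for j
      using Suc.prems(3)[of "Suc j"] that by (simp add: shift_def)
    have d: "dist (\<pi> (shift \<omega>)) (\<pi> (shift \<omega>')) \<le> M * r ^ n"
      by (rule dist_coding_map_le[OF sh agree])
    have "exp (\<phi> \<omega>') \<le> exp (\<phi> \<omega>) * exp (c * dist (\<pi> (shift \<omega>)) (\<pi> (shift \<omega>')) powr \<beta>)"
      unfolding exp_potential[OF Suc.prems(1)] exp_potential[OF Suc.prems(2)] e
      using distortion[OF path_edge(1)[OF Suc.prems(1), of 0]]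
        coding_map_shift_in_U[OF Suc.prems(1)] coding_map_shift_in_U[OF Suc.prems(2)] e
      by simp
    also have "\<dots> \<le> exp (\<phi> \<omega>) * exp ?D"
      using d c \<beta> by (simp add: powr_mono2)
    finally have "\<phi> \<omega>' \<le> \<phi> \<omega> + ?D" by (simp flip: exp_add)
    with Suc.IH[OF sh agree] show ?case
      unfolding birkhoff_Suc sum.lessThan_Suc[of "\<lambda>i. c * (M * r ^ i) powr \<beta>"] by linarith
  qed simp
  with distortion_sum_le[OF M, of n] show ?thesis by linarith
qed

text \<open>By induction, one map at a time. The distance \<open>\<rho>\<close> reached so far is at most \<open>a r\<^sup>n\<close>, because
  the lower derivative bound is also below the contraction ratio. So the ball of radius \<open>\<rho>\<close> on which
  the conorm must be controlled shrinks geometrically, which keeps the total distortion bounded.\<close>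

lemma dist_coding_map_ge:
  assumes "\<omega> \<in> X" "\<omega>' \<in> X" "\<And>j. j \<le> n \<Longrightarrow> \<omega> j = \<omega>' j"
    and a: "0 < a" "a \<le> \<delta>"
    and far: "a \<le> dist (\<pi> ((shift ^^ n) \<omega>)) (\<pi> ((shift ^^ n) \<omega>'))"
  shows "a * exp (S n \<omega> - distortion_const a) \<le> dist (\<pi> \<omega>) (\<pi> \<omega>')"
proof -
  define \<Gamma> where "\<Gamma> n = (\<Sum>i<n. c * (a * r ^ i) powr \<beta>)" for n
  have "a * exp (S n \<omega> - \<Gamma> n) \<le> dist (\<pi> \<omega>) (\<pi> \<omega>')"
    using assms(1-3) far
  proof (induction n arbitrary: \<omega> \<omega>')
    case 0
    then show ?case by (simp add: \<Gamma>_def)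
  next
    case (Suc n)
    let ?e = "edge G (\<omega> 0) (\<omega> 1)" and ?x = "\<pi> (shift \<omega>)" and ?y = "\<pi> (shift \<omega>')"
    let ?D = "c * (a * r ^ n) powr \<beta>"
    have e: "edge G (\<omega>' 0) (\<omega>' 1) = ?e" using Suc.prems(3)[of 0] Suc.prems(3)[of 1] by (simp only: zero_le One_nat_def Suc_le_mono)
    note sh = path_space_shift[OF Suc.prems(1)] path_space_shift[OF Suc.prems(2)]
    have agree: "shift \<omega> j = shift \<omega>' j" if "j \<le> n" for j
      using Suc.prems(3)[of "Suc j"] that by (simp add: shift_def)
    define \<rho> where "\<rho> = a * exp (S n (shift \<omega>) - \<Gamma> n)"
    have \<rho>0: "0 < \<rho>" using a by (simp add: \<rho>_def)
    have IH: "\<rho> \<le> dist ?x ?y"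
      unfolding \<rho>_def
      using Suc.prems(4) unfolding funpow_Suc_right comp_apply by (intro Suc.IH[OF sh agree])
    have "0 \<le> \<Gamma> n" using c by (auto simp: \<Gamma>_def intro!: sum_nonneg)
    then have "exp (S n (shift \<omega>) - \<Gamma> n) \<le> exp (S n (shift \<omega>))" by simp
    also have "\<dots> \<le> r ^ n" by (rule exp_birkhoff_le[OF sh(1)])
    finally have \<rho>r: "\<rho> \<le> a * r ^ n" using a by (simp add: \<rho>_def)
    also have "\<dots> \<le> a" using a r by (intro mult_left_le power_le_one) simp_all
    finally have \<rho>\<delta>: "\<rho> \<le> \<delta>" using a by simp
    have ea: "?e \<in> arcs G" "head G ?e = \<omega> 1"
      using path_edge(1,3)[OF Suc.prems(1), of 0] by simp_all
    have xJ: "?x \<in> J (\<omega> 1)" using coding_map_in_J[OF sh(1)] by (simp add: shift_def)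
    have ball: "cball ?x \<rho> \<subseteq> U (head G ?e)"
      using cball_subset[OF path_vert[OF Suc.prems(1)] xJ] \<rho>\<delta> unfolding ea(2) by auto
    have xU: "?x \<in> U (head G ?e)" by (rule coding_map_shift_in_U[OF Suc.prems(1)])
    have yU: "?y \<in> U (head G ?e)" using coding_map_shift_in_U[OF Suc.prems(2)] unfolding e .
    have "exp (\<phi> \<omega> - ?D) * \<rho> \<le> dist (T ?e ?x) (T ?e ?y)"
    proof (rule C1_diffeo_expands_outside_ball[OF T_diffeo[OF ea(1)] _ ball \<rho>0 yU IH])
      show "open (U (head G ?e))" using U_set[OF path_vert[OF Suc.prems(1)]] unfolding ea(2) by blast
      fix z assume z: "z \<in> cball ?x \<rho>"
      have zU: "z \<in> U (head G ?e)" using z ball by (rule rev_subsetD)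
      have "dist z ?x powr \<beta> \<le> (a * r ^ n) powr \<beta>"
        using z[unfolded mem_cball dist_commute[of ?x z]] \<rho>r
        by (intro powr_mono2[OF less_imp_le[OF \<beta>] zero_le_dist]) (rule order_trans)
      then have "c * dist z ?x powr \<beta> \<le> ?D" by (rule mult_left_mono[OF _ less_imp_le[OF c]])
      then have "exp (c * dist z ?x powr \<beta>) \<le> exp ?D" by (rule exp_le_cancel_iff[THEN iffD2])
      moreover have "exp (\<phi> \<omega>) \<le> conorm (deriv_at (T ?e) z) * exp (c * dist z ?x powr \<beta>)"
        unfolding exp_potential[OF Suc.prems(1)] by (rule distortion[OF ea(1) zU xU])
      ultimately have "exp (\<phi> \<omega>) \<le> conorm (deriv_at (T ?e) z) * exp ?D"
        using conorm_pos[OF ea(1) zU] by (meson less_imp_le mult_left_mono order_trans)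
      then show "exp (\<phi> \<omega> - ?D) \<le> conorm (deriv_at (T ?e) z)"
        by (simp add: exp_diff field_simps)
    qed simp
    moreover have "S (Suc n) \<omega> - \<Gamma> (Suc n) = (\<phi> \<omega> - ?D) + (S n (shift \<omega>) - \<Gamma> n)"
      unfolding birkhoff_Suc \<Gamma>_def sum.lessThan_Suc[of "\<lambda>i. c * (a * r ^ i) powr \<beta>"] by linarith
    then have "exp (\<phi> \<omega> - ?D) * \<rho> = a * exp (S (Suc n) \<omega> - \<Gamma> (Suc n))"
      by (simp only: \<rho>_def exp_add mult_ac)
    ultimately show ?case
      unfolding coding_map_shift[OF Suc.prems(1)] coding_map_shift[OF Suc.prems(2)] e by linarith
  qed
  moreover have "a * exp (S n \<omega> - distortion_const a) \<le> a * exp (S n \<omega> - \<Gamma> n)"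
    using distortion_sum_le[OF a(1), of n] a(1) by (simp add: \<Gamma>_def)
  ultimately show ?thesis by linarith
qed

end

section \<open>Concatenating loops\<close>

text \<open>All blocks have the same length \<open>l\<close>, so concatenation is explicit.\<close>

definition concat_blocks :: "nat \<Rightarrow> (nat \<Rightarrow> 'v list) \<Rightarrow> nat \<Rightarrow> 'v" where
  "concat_blocks l a n = a (n div l) ! (n mod l)"

lemma shift_concat_blocks:
  assumes "0 < l"
  shows "(shift ^^ (k * l)) (concat_blocks l a) = concat_blocks l (\<lambda>j. a (j + k))"
  using assms by (simp add: shift_funpow concat_blocks_def fun_eq_iff add.commute[of k])

context distorted_gifs
begin

text \<open>Nonempty cylinders are the words that occur along infinite paths, so \<open>L @ [v]\<close> is a closed walk. As
  in \<open>gen_function_insert\<close> below, \<open>hd (L @ [v]) = v\<close> also admits the empty loop.\<close>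

definition loops :: "'v \<Rightarrow> nat \<Rightarrow> 'v list set" where
  "loops v l = {L. length L = l \<and> hd (L @ [v]) = v \<and> cylinder G (L @ [v]) \<noteq> {}}"

lemma loop_witness:
  assumes "L \<in> loops v l" "0 < l"
  obtains \<omega> where "\<omega> \<in> X" "\<omega> 0 = v" "\<omega> l = v" "\<And>i. i < l \<Longrightarrow> \<omega> i = L ! i"
proof -
  obtain \<omega> where \<omega>: "\<omega> \<in> X" "map \<omega> [0..<Suc l] = L @ [v]" and L: "length L = l" "hd (L @ [v]) = v"
    using assms by (auto simp: loops_def cylinder_def)
  have nth: "\<omega> i = (L @ [v]) ! i" if "i \<le> l" for i
    using arg_cong[OF \<omega>(2), of "\<lambda>xs. xs ! i"] that by (simp del: upt_Suc)
  have "\<omega> 0 = v" using nth[of 0] L(2) by (cases L) (auto simp: hd_conv_nth)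
  moreover have "\<omega> l = v" using nth[of l] L by (metis nth_append_length order_refl)
  moreover have "\<omega> i = L ! i" if "i < l" for i using nth[of i] that L by (simp add: nth_append)
  ultimately show ?thesis using that \<omega>(1) by blast
qed

lemma concat_blocks_witness:
  assumes "range a \<subseteq> loops v l" "0 < l" "\<omega> 0 = v" "\<omega> l = v" "\<And>i. i < l \<Longrightarrow> \<omega> i = a k ! i"
    and "j \<le> l"
  shows "concat_blocks l a (k * l + j) = \<omega> j"
proof (cases "j < l")
  case True
  then show ?thesis using assms by (simp add: concat_blocks_def)
next
  case False
  then have j: "j = l" using assms by simp
  obtain \<omega>' where "\<omega>' 0 = v" "\<And>i. i < l \<Longrightarrow> \<omega>' i = a (Suc k) ! i"
    using loop_witness[of "a (Suc k)" v l] assms(1,2) by blast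
  then have "a (Suc k) ! 0 = v" using assms(2) by metis
  then show ?thesis using assms(2,4) j by (simp add: concat_blocks_def)
qed

lemma concat_blocks_mult:
  assumes "range a \<subseteq> loops v l" "0 < l"
  shows "concat_blocks l a (k * l) = v"
proof -
  obtain \<omega> where "\<omega> 0 = v" "\<omega> l = v" "\<And>i. i < l \<Longrightarrow> \<omega> i = a k ! i"
    using loop_witness[of "a k" v l] assms by blast
  from concat_blocks_witness[of a v l \<omega> k 0] this assms show ?thesis by simp
qed

lemma concat_blocks_in_path_space:
  assumes "range a \<subseteq> loops v l" "0 < l"
  shows "concat_blocks l a \<in> X"
proof -
  have "concat_blocks l a n \<in> verts G \<and>
    (concat_blocks l a n, concat_blocks l a (Suc n)) \<in> arcs_ends G" for n
  proof -
    define k i where "k = n div l" and "i = n mod l"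
    have n: "n = k * l + i" "i < l" using assms(2) by (auto simp: k_def i_def)
    obtain \<omega> where \<omega>: "\<omega> \<in> X" "\<omega> 0 = v" "\<omega> l = v" "\<And>i. i < l \<Longrightarrow> \<omega> i = a k ! i"
      using loop_witness[of "a k" v l] assms by blast
    have "concat_blocks l a (k * l + i) = \<omega> i"
      by (rule concat_blocks_witness[OF assms \<omega>(2-4)]) (use n in simp_all)
    moreover have "concat_blocks l a (k * l + Suc i) = \<omega> (Suc i)"
      by (rule concat_blocks_witness[OF assms \<omega>(2-4)]) (use n in simp_all)
    ultimately show ?thesis using \<omega>(1) n by (simp add: path_space_def)
  qed
  then show ?thesis by (simp add: path_space_def)
qed

lemma concat_blocks_in_cylinder:
  assumes "range a \<subseteq> loops v l" "0 < l"
  shows "concat_blocks l a \<in> cylinder G (a 0 @ [v])"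
proof -
  have len: "length (a 0) = l" using assms by (auto simp: loops_def)
  have "map (concat_blocks l a) [0..<l] = a 0"
    using len by (intro nth_equalityI) (auto simp: concat_blocks_def)
  moreover have "concat_blocks l a l = v" using concat_blocks_mult[OF assms, of 1] by simp
  ultimately show ?thesis
    using len concat_blocks_in_path_space[OF assms] by (simp add: cylinder_def)
qed

lemma concat_blocks_agree:
  assumes "range a \<subseteq> loops v l" "range b \<subseteq> loops v l" "0 < l" "\<And>i. i < k \<Longrightarrow> a i = b i" "j \<le> k * l"
  shows "concat_blocks l a j = concat_blocks l b j"
proof (cases "j = k * l")
  case True
  then show ?thesis using concat_blocks_mult assms by metis
next
  case False
  then have "j div l < k" using assms by (simp add: less_mult_imp_div_less)
  then show ?thesis using assms by (simp add: concat_blocks_def)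
qed

lemma concat_blocks_neq:
  assumes "range a \<subseteq> loops v l" "range b \<subseteq> loops v l" "0 < l" "a 0 \<noteq> b 0"
  shows "concat_blocks l a \<noteq> concat_blocks l b"
proof
  assume eq: "concat_blocks l a = concat_blocks l b"
  have "length (a 0) = l" "length (b 0) = l" using assms by (auto simp: loops_def)
  moreover have "a 0 ! i = b 0 ! i" if "i < l" for i
    using fun_cong[OF eq, of i] that by (simp add: concat_blocks_def)
  ultimately show False using assms(4) by (auto intro: nth_equalityI)
qed

text \<open>Compactness of the set of loop sequences, in the form of a descent on pairs of words: if no
  \<open>d\<close> worked, finiteness of \<open>W\<close> would give two infinite sequences with different first loops, all of
  whose beginnings extend to arbitrarily close points; since the coding map is continuous, their own
  points coincide, against injectivity.\<close>

lemma loops_separated: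
  assumes W: "finite W" "W \<subseteq> loops v l" and l: "0 < l"
  obtains d where "0 < d" "\<And>a b. range a \<subseteq> W \<Longrightarrow> range b \<subseteq> W \<Longrightarrow> a 0 \<noteq> b 0 \<Longrightarrow>
    d \<le> dist (\<pi> (concat_blocks l a)) (\<pi> (concat_blocks l b))"
proof (rule ccontr)
  let ?p = "\<lambda>a. \<pi> (concat_blocks l a)"
  define near where "near u \<epsilon> a b \<longleftrightarrow> range a \<subseteq> W \<and> range b \<subseteq> W \<and> a 0 \<noteq> b 0 \<and>
    map (\<lambda>i. (a i, b i)) [0..<length u] = u \<and> dist (?p a) (?p b) < \<epsilon>" for u \<epsilon> a b
  define P where "P u \<longleftrightarrow> (\<forall>\<epsilon>>0. \<exists>a b. near u \<epsilon> a b)" for u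
  assume "\<not> thesis"
  have "P []"
    unfolding P_def
  proof (intro allI impI, rule ccontr)
    fix \<epsilon> :: real assume "0 < \<epsilon>" "\<not> (\<exists>a b. near [] \<epsilon> a b)"
    then have thesis by (intro that[of \<epsilon>]) (auto simp: near_def not_less)
    with \<open>\<not> thesis\<close> show False by simp
  qed
  moreover have "\<exists>p\<in>W \<times> W. P (u @ [p])" if "P u" for u
  proof (rule ccontr)
    assume "\<not> ?thesis"
    then have "\<forall>p\<in>W \<times> W. \<exists>e>0. \<forall>a b. \<not> near (u @ [p]) e a b" by (auto simp: P_def)
    then obtain e where e: "\<And>p. p \<in> W \<times> W \<Longrightarrow> 0 < e p" "\<And>p a b. p \<in> W \<times> W \<Longrightarrow> \<not> near (u @ [p]) (e p) a b"
      by metis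
    define \<epsilon> where "\<epsilon> = Min (insert 1 (e ` (W \<times> W)))"
    have "0 < \<epsilon>" using e(1) W(1) by (auto simp: \<epsilon>_def)
    then obtain a b where ab: "near u \<epsilon> a b" using \<open>P u\<close> by (auto simp: P_def)
    let ?q = "(a (length u), b (length u))"
    have q: "?q \<in> W \<times> W" using ab by (auto simp: near_def)
    then have "\<epsilon> \<le> e ?q" using W(1) by (auto simp: \<epsilon>_def intro!: Min_le)
    then have "near (u @ [?q]) (e ?q) a b" using ab by (auto simp: near_def)
    with e(2)[OF q] show False by blast
  qed
  ultimately obtain x where x: "\<And>n. x n \<in> W \<times> W" "\<And>k. P (map x [0..<k])"
    using infinite_branch[of P "W \<times> W"] by metis
  define a where "a = (\<lambda>i. fst (x i))"
  define b where "b = (\<lambda>i. snd (x i))"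
  have "x i \<in> W \<times> W" for i by (rule x)
  then have "a i \<in> W" "b i \<in> W" for i by (auto simp: a_def b_def mem_Times_iff)
  then have ab: "range a \<subseteq> W" "range b \<subseteq> W" by auto
  have approx: "dist (?p a) (?p b) \<le> 3 * \<epsilon>" and ab0: "a 0 \<noteq> b 0" if eps: "0 < \<epsilon>" for \<epsilon>
  proof -
    obtain k0 where k0: "r ^ k0 < \<epsilon> / M" using real_arch_pow_inv[of "\<epsilon> / M" r] r M eps by auto
    \<comment> \<open>The successor makes sure that the first loops are among those compared.\<close>
    define k where "k = Suc k0"
    obtain a' b' where n: "near (map x [0..<k]) \<epsilon> a' b'" using x(2)[of k] eps by (auto simp: P_def)
    then have "map (\<lambda>i. (a' i, b' i)) [0..<k] = map x [0..<k]" by (simp add: near_def)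
    then have pair: "(a' i, b' i) = x i" if "i < k" for i using that by (simp add: map_eq_conv)
    have eq: "a' i = a i" "b' i = b i" if "i < k" for i
      unfolding a_def b_def pair[OF that, symmetric] by simp_all
    have ranges: "range a' \<subseteq> W" "range b' \<subseteq> W" using n by (auto simp: near_def)
    show "a 0 \<noteq> b 0" using n eq[of 0] by (simp add: near_def k_def)
    have close: "dist (?p f) (?p g) \<le> \<epsilon>" if fg: "range f \<subseteq> W" "range g \<subseteq> W" "\<And>i. i < k \<Longrightarrow> f i = g i" for f g
    proof -
      have fg': "range f \<subseteq> loops v l" "range g \<subseteq> loops v l" using fg W by auto
      have "dist (?p f) (?p g) \<le> M * r ^ (k * l)"
        by (rule dist_coding_map_le[OF concat_blocks_in_path_space[OF fg'(1) l]
              concat_blocks_in_path_space[OF fg'(2) l] concat_blocks_agree[OF fg' l fg(3)]])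
      also have "k0 \<le> k * l" using l by (cases l) (auto simp: k_def)
      then have "M * r ^ (k * l) \<le> M * r ^ k0"
        using M r by (intro mult_left_mono power_decreasing) auto
      also have "\<dots> \<le> \<epsilon>" using k0 M by (simp add: field_simps)
      finally show ?thesis by simp
    qed
    have "dist (?p a) (?p b) \<le> dist (?p a) (?p a') + dist (?p a') (?p b') + dist (?p b') (?p b)"
      using dist_triangle[of "?p a" "?p b" "?p a'"] dist_triangle[of "?p a'" "?p b" "?p b'"] by linarith
    moreover have "dist (?p a') (?p b') < \<epsilon>" using n by (simp add: near_def)
    moreover have "dist (?p a) (?p a') \<le> \<epsilon>" by (rule close[OF ab(1) ranges(1)]) (simp add: eq)
    moreover have "dist (?p b') (?p b) \<le> \<epsilon>" by (rule close[OF ranges(2) ab(2)]) (simp add: eq)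
    ultimately show "dist (?p a) (?p b) \<le> 3 * \<epsilon>" by linarith
  qed
  have "dist (?p a) (?p b) = 0"
  proof (rule ccontr)
    assume "dist (?p a) (?p b) \<noteq> 0"
    then have "0 < dist (?p a) (?p b)" by (simp add: zero_less_dist_iff)
    with approx[of "dist (?p a) (?p b) / 4"] show False by linarith
  qed
  then have "?p a = ?p b" by simp
  then have "concat_blocks l a = concat_blocks l b"
    by (rule coding_map_inj[OF concat_blocks_in_path_space[OF order_trans[OF ab(1) W(2)] l]
          concat_blocks_in_path_space[OF order_trans[OF ab(2) W(2)] l]])
  with concat_blocks_neq[OF order_trans[OF ab(1) W(2)] order_trans[OF ab(2) W(2)] l ab0[of 1]]
  show False by simp
qed

lemma prod_le_exp_birkhoff:
  assumes a: "range a \<subseteq> loops v l" and l: "0 < l"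
    and w: "\<And>L \<omega>. L \<in> range a \<Longrightarrow> \<omega> \<in> cylinder G (L @ [v]) \<Longrightarrow> w L \<le> exp (S l \<omega>)"
    and w0: "\<And>L. L \<in> range a \<Longrightarrow> 0 < w L"
  shows "(\<Prod>j<k. w (a j)) \<le> exp (S (k * l) (concat_blocks l a))"
proof (induction k)
  case (Suc k)
  have "range (\<lambda>j. a (j + k)) \<subseteq> loops v l" using a by auto
  from concat_blocks_in_cylinder[OF this l]
  have "w (a k) \<le> exp (S l (concat_blocks l (\<lambda>j. a (j + k))))" by (intro w) auto
  then have wk: "w (a k) \<le> exp (S l ((shift ^^ (k * l)) (concat_blocks l a)))"
    unfolding shift_concat_blocks[OF l] .
  have "(\<Prod>j<Suc k. w (a j)) \<le> exp (S (k * l) (concat_blocks l a)) *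
      exp (S l ((shift ^^ (k * l)) (concat_blocks l a)))"
    unfolding prod.lessThan_Suc
    by (intro mult_mono Suc wk prod_nonneg) (auto intro!: less_imp_le w0)
  also have "\<dots> = exp (S (k * l + l) (concat_blocks l a))"
    unfolding birkhoff_add exp_add ..
  finally show ?case by (simp only: mult_Suc add.commute)
qed simp

text \<open>A vertex with sufficiently heavy loops forces positive measure: the concatenations of
  its loops form a separated tree inside the limit set.\<close>

lemma hausdorff_measure_limit_set_pos:
  assumes W: "finite W" "W \<subseteq> loops v l" and l: "0 < l"
    and w: "\<And>L \<omega>. L \<in> W \<Longrightarrow> \<omega> \<in> cylinder G (L @ [v]) \<Longrightarrow> w L \<le> exp (S l \<omega>)"
    and w0: "\<And>L. L \<in> W \<Longrightarrow> 0 < w L"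
    and t: "0 < t" "1 \<le> (\<Sum>L\<in>W. w L powr t)" and d: "0 \<le> d" "d \<le> t"
  shows "hausdorff_measure d (limit_set G J T) \<noteq> 0"
proof -
  let ?p = "\<lambda>a. \<pi> (concat_blocks l a)"
  obtain d0 where d0: "0 < d0" "\<And>a b. range a \<subseteq> W \<Longrightarrow> range b \<subseteq> W \<Longrightarrow> a 0 \<noteq> b 0 \<Longrightarrow>
    d0 \<le> dist (?p a) (?p b)"
    by (rule loops_separated[OF W l]) (rule that)
  \<comment> \<open>The separation must not exceed the collar, in which the distortion estimate is valid.\<close>
  define s where "s = min d0 \<delta>"
  have s: "0 < s" "s \<le> \<delta>" "s \<le> d0" using d0 \<delta> by (auto simp: s_def)
  define \<kappa> where "\<kappa> = s * exp (- distortion_const s)"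
  show ?thesis
  proof (rule hausdorff_measure_pos_of_separated_tree[where \<pi> = ?p and \<rho> = "r ^ l" and \<kappa> = \<kappa>])
    show "finite W" "0 < t" "1 \<le> (\<Sum>L\<in>W. w L powr t)" "0 \<le> d" "d \<le> t" by fact+
    show "r ^ l < 1" using r l by (simp add: power_less_one_iff)
    show "0 < \<kappa>" using s by (simp add: \<kappa>_def)
    show "0 < w L \<and> w L \<le> r ^ l" if "L \<in> W" for L
    proof -
      have a: "range (\<lambda>_::nat. L) \<subseteq> loops v l" using that W by auto
      have "w L \<le> exp (S l (concat_blocks l (\<lambda>_. L)))"
        by (rule w[OF that]) (rule concat_blocks_in_cylinder[OF a l])
      also have "\<dots> \<le> r ^ l" by (rule exp_birkhoff_le[OF concat_blocks_in_path_space[OF a l]])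
      finally show ?thesis using w0[OF that] by simp
    qed
    show "?p a \<in> limit_set G J T" if "range a \<subseteq> W" for a
      using that W l by (intro coding_map_in_limit_set concat_blocks_in_path_space) auto
    show "\<kappa> * (\<Prod>j<k. w (a j)) \<le> dist (?p a) (?p b)"
      if ab: "range a \<subseteq> W" "range b \<subseteq> W" and agree: "\<And>j. j < k \<Longrightarrow> a j = b j" and "a k \<noteq> b k" for a b k
    proof -
      have ab': "range a \<subseteq> loops v l" "range b \<subseteq> loops v l" using ab W by auto
      have far: "s \<le> dist (\<pi> ((shift ^^ (k * l)) (concat_blocks l a))) (\<pi> ((shift ^^ (k * l)) (concat_blocks l b)))"
        unfolding shift_concat_blocks[OF l]
        by (rule order_trans[OF s(3) d0(2)]) (use ab \<open>a k \<noteq> b k\<close> in auto)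
      have "(\<Prod>j<k. w (a j)) \<le> exp (S (k * l) (concat_blocks l a))"
        using ab W by (intro prod_le_exp_birkhoff[OF ab'(1) l] w w0) auto
      then have "\<kappa> * (\<Prod>j<k. w (a j)) \<le> \<kappa> * exp (S (k * l) (concat_blocks l a))"
        using s by (intro mult_left_mono) (auto simp: \<kappa>_def)
      also have "\<dots> = s * exp (S (k * l) (concat_blocks l a) - distortion_const s)"
        by (simp add: \<kappa>_def exp_diff exp_minus divide_inverse mult_ac)
      also have "\<dots> \<le> dist (?p a) (?p b)"
        by (rule dist_coding_map_ge[OF concat_blocks_in_path_space[OF ab'(1) l]
              concat_blocks_in_path_space[OF ab'(2) l] concat_blocks_agree[OF ab' l agree] s(1,2) far])
      finally show ?thesis .
    qed
  qed
qed

end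

section \<open>Sums of weights and their growth rate\<close>

lemma ennreal_summable_on: "(f :: 'a \<Rightarrow> ennreal) summable_on A"
  by (rule nonneg_summable_on_complete) simp

lemma infsum_ennreal_le:
  fixes f :: "'a \<Rightarrow> ennreal"
  assumes "\<And>F. finite F \<Longrightarrow> F \<subseteq> A \<Longrightarrow> sum f F \<le> b"
  shows "infsum f A \<le> b"
  by (rule infsum_le_finite_sums[OF ennreal_summable_on assms])

text \<open>Used to bound a sum over words by a sum over ways to cut them into pieces, where only some way of
  cutting each word has to be given.\<close>

lemma infsum_ennreal_le_of_cover:
  fixes f :: "'a \<Rightarrow> ennreal" and g :: "'b \<Rightarrow> ennreal"
  assumes "\<And>x. x \<in> A \<Longrightarrow> \<exists>y\<in>B. k y = x \<and> f x \<le> g y"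
  shows "infsum f A \<le> infsum g B"
proof -
  obtain h where h: "\<And>x. x \<in> A \<Longrightarrow> h x \<in> B" "\<And>x. x \<in> A \<Longrightarrow> k (h x) = x" "\<And>x. x \<in> A \<Longrightarrow> f x \<le> g (h x)"
    using assms by metis
  have inj: "inj_on h A" using h(2) by (rule inj_on_inverseI)
  have "infsum f A \<le> infsum (g \<circ> h) A"
    by (rule infsum_mono[OF ennreal_summable_on ennreal_summable_on]) (use h(3) in auto)
  also have "\<dots> = infsum g (h ` A)"
    by (rule infsum_reindex[OF inj, symmetric])
  also have "\<dots> \<le> infsum g B"
    by (rule infsum_mono_neutral[OF ennreal_summable_on ennreal_summable_on]) (use h(1) in auto)
  finally show ?thesis .
qed

lemma infsum_ennreal_mono_set:
  fixes f g :: "'a \<Rightarrow> ennreal"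
  assumes "A \<subseteq> B" "\<And>x. x \<in> A \<Longrightarrow> f x \<le> g x"
  shows "infsum f A \<le> infsum g B"
  by (rule infsum_mono_neutral[OF ennreal_summable_on ennreal_summable_on]) (use assms in auto)

lemma sum_le_infsum_ennreal:
  fixes f :: "'a \<Rightarrow> ennreal"
  assumes "finite F" "F \<subseteq> A"
  shows "sum f F \<le> infsum f A"
  using infsum_ennreal_mono_set[of F A f f] assms by simp

lemma cmult_infsum_ennreal:
  fixes f :: "'a \<Rightarrow> ennreal"
  shows "c * infsum f A = infsum (\<lambda>x. c * f x) A"
proof -
  have "c * infsum f A = (SUP F\<in>{F. finite F \<and> F \<subseteq> A}. c * sum f F)"
    by (subst nonneg_infsum_complete) (auto intro: SUP_mult_left_ennreal)
  then show ?thesis by (simp add: nonneg_infsum_complete sum_distrib_left)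
qed

lemma infsum_ennreal_Times_le:
  fixes f :: "'a \<Rightarrow> ennreal" and g :: "'b \<Rightarrow> ennreal"
  shows "infsum (\<lambda>(a, b). f a * g b) (A \<times> B) \<le> infsum f A * infsum g B"
proof (rule infsum_ennreal_le)
  fix F assume F: "finite F" "F \<subseteq> A \<times> B"
  have "(\<Sum>(a, b)\<in>F. f a * g b) \<le> (\<Sum>(a, b)\<in>fst ` F \<times> snd ` F. f a * g b)"
    by (rule sum_mono2) (use F in force)+
  also have "\<dots> = sum f (fst ` F) * sum g (snd ` F)"
    by (simp add: sum_product sum.cartesian_product)
  also have "\<dots> \<le> infsum f A * infsum g B"
    by (intro mult_mono sum_le_infsum_ennreal) (use F in auto)
  finally show "(\<Sum>(a, b)\<in>F. f a * g b) \<le> infsum f A * infsum g B" .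
qed

lemma infsum_ennreal_le_suminf_length:
  fixes g :: "'a list \<Rightarrow> ennreal"
  assumes "\<And>n. infsum g {w \<in> A. length w = n} \<le> b n"
  shows "infsum g A \<le> (\<Sum>n. b n)"
proof (rule infsum_ennreal_le)
  fix F assume F: "finite F" "F \<subseteq> A"
  have "sum g F = (\<Sum>n\<in>length ` F. sum g {w \<in> F. length w = n})"
    by (rule sum.image_gen[OF F(1)])
  also have "\<dots> \<le> (\<Sum>n\<in>length ` F. b n)"
  proof (rule sum_mono)
    fix n
    have "sum g {w \<in> F. length w = n} \<le> infsum g {w \<in> A. length w = n}"
      by (rule sum_le_infsum_ennreal) (use F in auto)
    then show "sum g {w \<in> F. length w = n} \<le> b n" using assms order_trans by blast
  qed
  also have "\<dots> \<le> (\<Sum>n. b n)"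
    by (rule sum_le_suminf) (use F in auto)
  finally show "sum g F \<le> (\<Sum>n. b n)" .
qed

lemma infsum_ennreal_small_tail:
  fixes f :: "'a \<Rightarrow> ennreal"
  assumes fin: "infsum f A < \<infinity>" and e: "0 < e"
  obtains F where "finite F" "F \<subseteq> A" "infsum f (A - F) \<le> ennreal e"
proof (rule ccontr)
  assume no: "\<not> thesis"
  note obt = that
  obtain a where a: "0 \<le> a" "infsum f A = ennreal a" using fin by (cases "infsum f A") auto
  have le: "sum f F + ennreal e \<le> ennreal a" if F: "finite F" "F \<subseteq> A" for F
  proof -
    have "infsum f A = infsum f F + infsum f (A - F)"
      using infsum_Un_disjoint[OF ennreal_summable_on ennreal_summable_on, of F "A - F" f] F(2)
      by (simp add: Un_absorb1)
    moreover have "ennreal e \<le> infsum f (A - F)" using no obt[OF F] by (metis nle_le)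
    ultimately show ?thesis using F a by (simp add: add_left_mono)
  qed
  have ea: "e \<le> a" using le[of "{}"] e a by (simp add: ennreal_le_iff)
  have "infsum f A \<le> ennreal (a - e)"
  proof (rule infsum_ennreal_le)
    fix F assume F: "finite F" "F \<subseteq> A"
    have "sum f F \<le> ennreal a" using le[OF F] by (metis add_increasing2 order_trans zero_le le_iff_add)
    then obtain s where s: "0 \<le> s" "sum f F = ennreal s" by (cases "sum f F") (auto simp: top_unique)
    then have "ennreal (s + e) \<le> ennreal a" using le[OF F] e by simp
    then have "s + e \<le> a" using a by (simp add: ennreal_le_iff)
    then show "sum f F \<le> ennreal (a - e)" unfolding s(2) by (intro ennreal_leI) simp
  qed
  then have "ennreal a \<le> ennreal (a - e)" using a by simp
  then show False using ea e by (simp add: ennreal_le_iff)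
qed

lemma exp_ereal_SUP:
  assumes "A \<noteq> {}" "\<And>x. x \<in> A \<Longrightarrow> f x \<le> b"
  shows "exp_ereal (SUP x\<in>A. ereal (f x)) = (SUP x\<in>A. ennreal (exp (f x)))"
proof -
  define \<sigma> where "\<sigma> = (SUP x\<in>A. f x)"
  have bdd: "bdd_above (f ` A)" using assms(2) by (rule bdd_aboveI2)
  have up: "f x \<le> \<sigma>" if "x \<in> A" for x unfolding \<sigma>_def by (rule cSUP_upper[OF that bdd])
  have "(SUP x\<in>A. ereal (f x)) = ereal \<sigma>"
  proof (rule antisym)
    show "(SUP x\<in>A. ereal (f x)) \<le> ereal \<sigma>" by (rule SUP_least) (simp add: up)
    show "ereal \<sigma> \<le> (SUP x\<in>A. ereal (f x))"
    proof (rule ereal_le_real)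
      fix z assume z: "(SUP x\<in>A. ereal (f x)) \<le> ereal z"
      have "f x \<le> z" if "x \<in> A" for x
        using order_trans[OF SUP_upper[OF that, of "\<lambda>x. ereal (f x)"] z] by simp
      then show "ereal \<sigma> \<le> ereal z" unfolding \<sigma>_def using assms(1) by (auto intro: cSUP_least)
    qed
  qed
  then have L: "exp_ereal (SUP x\<in>A. ereal (f x)) = ennreal (exp \<sigma>)" by (simp add: exp_ereal_def)
  have "ennreal (exp \<sigma>) \<le> (SUP x\<in>A. ennreal (exp (f x)))"
  proof (rule ccontr)
    assume "\<not> ?thesis"
    then have lt: "(SUP x\<in>A. ennreal (exp (f x))) < ennreal (exp \<sigma>)" by simp
    then obtain B where B: "0 \<le> B" "(SUP x\<in>A. ennreal (exp (f x))) = ennreal B"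
      by (cases "(SUP x\<in>A. ennreal (exp (f x)))") auto
    have fx: "exp (f x) \<le> B" if "x \<in> A" for x
      using SUP_upper[OF that, of "\<lambda>x. ennreal (exp (f x))"] B by (simp add: ennreal_le_iff)
    obtain x0 where "x0 \<in> A" using assms(1) by blast
    then have B0: "0 < B" using fx exp_gt_zero less_le_trans by blast
    have "\<sigma> \<le> ln B" unfolding \<sigma>_def
      by (rule cSUP_least[OF assms(1)]) (use fx B0 in \<open>simp add: ln_ge_iff\<close>)
    then have "exp \<sigma> \<le> B" using B0 by (simp add: ln_ge_iff)
    then show False using lt B(2) by (simp add: ennreal_less_iff[OF B(1)])
  qed
  moreover have "(SUP x\<in>A. ennreal (exp (f x))) \<le> ennreal (exp \<sigma>)"
    by (rule SUP_least) (use up in \<open>simp add: ennreal_leI\<close>)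
  ultimately show ?thesis using L by simp
qed

text \<open>Write \<open>n = qm + i\<close> with \<open>i < m\<close>; then \<open>a n \<le> q \<cdot> a m + a i\<close>, and replacing \<open>q\<close> by \<open>n / m\<close> costs at
  most \<open>\<bar>a m\<bar>\<close>.\<close>

lemma subadditive_div_le:
  fixes a :: "nat \<Rightarrow> real"
  assumes sub: "\<And>m n. a (m + n) \<le> a m + a n" and m: "0 < m"
  obtains K where "\<And>n. 0 < n \<Longrightarrow> a n / n \<le> a m / m + K / n"
proof -
  have mult: "a (q * m + i) \<le> q * a m + a i" for q i
  proof (induction q)
    case (Suc q)
    have "a (Suc q * m + i) \<le> a m + a (q * m + i)" using sub[of m "q * m + i"] by (simp add: add_ac)
    with Suc show ?case by (simp add: algebra_simps)
  qed simp
  define C where "C = Max ((\<lambda>i. \<bar>a i\<bar>) ` {..m})"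
  have C: "a i \<le> C" if "i \<le> m" for i
    unfolding C_def by (rule order_trans[OF abs_ge_self Max_ge]) (use that in auto)
  show ?thesis
  proof (rule that)
    fix n :: nat assume n: "0 < n"
    let ?q = "n div m" and ?i = "n mod m"
    have i: "?i \<le> m" using m by (simp add: less_imp_le)
    have qm: "real n = real ?q * real m + real ?i" by (metis div_mult_mod_eq of_nat_add of_nat_mult)
    have "a n \<le> ?q * a m + C" using mult[of ?q ?i] C[OF i] by simp
    also have "?q * a m = n * (a m / m) - ?i * (a m / m)"
      using m by (simp add: qm field_simps)
    also have "- (?i * (a m / m)) \<le> \<bar>a m\<bar>"
    proof -
      have "\<bar>?i * (a m / m)\<bar> = (?i / m) * \<bar>a m\<bar>" by (simp add: abs_mult)
      also have "\<dots> \<le> 1 * \<bar>a m\<bar>" using i m by (intro mult_right_mono) auto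
      finally show ?thesis by linarith
    qed
    then have "n * (a m / m) - ?i * (a m / m) + C \<le> n * (a m / m) + (\<bar>a m\<bar> + C)" by linarith
    finally have "a n \<le> n * (a m / m) + (\<bar>a m\<bar> + C)" .
    then have "a n / n \<le> (n * (a m / m) + (\<bar>a m\<bar> + C)) / n" by (rule divide_right_mono) simp
    also have "\<dots> = a m / m + (\<bar>a m\<bar> + C) / n" using n by (simp add: add_divide_distrib)
    finally show "a n / n \<le> a m / m + (\<bar>a m\<bar> + C) / n" .
  qed
qed

text \<open>Fekete's lemma in the extended reals. The limit may be \<open>-\<infinity>\<close>, either because some term vanishes or
  because the decay is superexponential.\<close>

lemma submultiplicative_growth_rate_converges:
  fixes Z :: "nat \<Rightarrow> ennreal"
  assumes sub: "\<And>m n. Z (m + n) \<le> Z m * Z n" and fin: "\<And>n. Z n < \<infinity>"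
  shows "\<exists>L. (\<lambda>n. ereal (1 / real n) * log_ennreal (Z n)) \<longlonglongrightarrow> L"
proof (cases "\<exists>m. Z m = 0")
  case True
  then obtain m where m: "Z m = 0" by blast
  have "Z n = 0" if "m \<le> n" for n
    using sub[of m "n - m"] that m by simp
  then have "\<exists>N. \<forall>n\<ge>N. ereal (1 / real n) * log_ennreal (Z n) = -\<infinity>"
    by (intro exI[of _ "Suc m"]) (auto simp: log_ennreal_def)
  then show ?thesis
    unfolding eventually_sequentially[symmetric] by (intro exI[of _ "-\<infinity>"] tendsto_eventually) auto
next
  case False
  define a where "a n = ln (enn2real (Z n))" for n
  have pos: "0 < enn2real (Z n)" for n
    using False fin by (simp add: enn2real_positive_iff zero_less_iff_neq_zero)
  have "a (m + n) \<le> a m + a n" for m n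
  proof -
    have "enn2real (Z (m + n)) \<le> enn2real (Z m * Z n)"
      by (rule enn2real_mono[OF sub]) (use fin in \<open>simp add: ennreal_mult_less_top\<close>)
    then have "ln (enn2real (Z (m + n))) \<le> ln (enn2real (Z m) * enn2real (Z n))"
      using pos by (simp add: enn2real_mult)
    then show ?thesis using pos[of m] pos[of n] by (simp add: a_def ln_mult)
  qed
  note subadd = subadditive_div_le[of a, OF this]
  define p where "p n = ereal (a n / n)" for n
  have p: "ereal (1 / real n) * log_ennreal (Z n) = p n" for n
    using False fin[of n] by (auto simp: log_ennreal_def a_def p_def)
  define L where "L = (INF m\<in>{0<..}. p m)"
  have "p \<longlonglongrightarrow> L"
  proof (rule order_tendstoI)
    fix y assume y: "y < L"
    have "y < p n" if "0 < n" for n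
      using y INF_lower[of n "{0<..}" p] that unfolding L_def by (auto intro: less_le_trans)
    then show "\<forall>\<^sub>F n in sequentially. y < p n"
      by (intro eventually_mono[OF eventually_gt_at_top[of 0]])
  next
    fix y assume "L < y"
    then obtain m where m: "0 < m" "p m < y" by (auto simp: L_def INF_less_iff)
    then obtain z where z: "a m / m < z" "ereal z < y"
      using ereal_dense2[of "p m" y] by (auto simp: p_def)
    obtain K where K: "\<And>n. 0 < n \<Longrightarrow> a n / n \<le> a m / m + K / n" using subadd[OF m(1)] by blast
    have "(\<lambda>n. a m / m + K / real n) \<longlonglongrightarrow> a m / m + 0"
      by (intro tendsto_add tendsto_const lim_const_over_n)
    then have "\<forall>\<^sub>F n in sequentially. a m / m + K / real n < z"
      by (rule order_tendstoD) (use z in simp)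
    then show "\<forall>\<^sub>F n in sequentially. p n < y"
      using eventually_gt_at_top[of 0]
    proof eventually_elim
      case (elim n)
      then have "a n / n < z" using K[of n] by linarith
      then have "p n < ereal z" by (simp add: p_def)
      then show ?case using z(2) by (rule less_trans)
    qed
  qed
  then show ?thesis unfolding p by blast
qed

lemma growth_rate_neg_of_geometric_bound:
  fixes Z :: "nat \<Rightarrow> ennreal"
  assumes bound: "\<And>n. ennreal (x ^ n) * Z n \<le> ennreal B" and x: "1 < x"
    and lim: "(\<lambda>n. ereal (1 / real n) * log_ennreal (Z n)) \<longlonglongrightarrow> L"
  shows "L < 0"
proof -
  define C where "C = max B 1"
  have C: "0 < C" by (simp add: C_def)
  have "(\<lambda>n. ereal (ln C / real n - ln x)) \<longlonglongrightarrow> ereal (0 - ln x)"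
    by (intro tendsto_intros lim_const_over_n)
  moreover have "\<forall>\<^sub>F n in sequentially.
    ereal (1 / real n) * log_ennreal (Z n) \<le> ereal (ln C / real n - ln x)"
    using eventually_gt_at_top[of 0]
  proof eventually_elim
    case (elim n)
    have le: "ennreal (x ^ n) * Z n \<le> ennreal C"
      using bound[of n] by (rule order_trans) (simp add: C_def ennreal_leI)
    have xn: "0 < x ^ n" using x by simp
    show ?case
    proof (cases "Z n")
      case (real z)
      show ?thesis
      proof (cases "z = 0")
        case False
        then have z: "0 < z" using real by simp
        have "ennreal (x ^ n * z) \<le> ennreal C" using le real xn by (simp add: ennreal_mult)
        then have "x ^ n * z \<le> C" using C by (simp add: ennreal_le_iff)
        then have "ln (x ^ n * z) \<le> ln C" using xn z C by (subst ln_le_cancel_iff) auto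
        then have "n * ln x + ln z \<le> ln C" using xn z x by (simp add: ln_mult ln_realpow)
        then have "ln z / n \<le> ln C / n - ln x" using elim by (simp add: field_simps)
        then show ?thesis using real z by (simp add: log_ennreal_def)
      qed (use real elim in \<open>simp add: log_ennreal_def\<close>)
    next
      case top
      then show ?thesis using le xn using x by (auto simp: ennreal_mult_top top_unique)
    qed
  qed
  ultimately have "L \<le> ereal (0 - ln x)"
    using lim by (intro tendsto_le[OF sequentially_bot]) auto
  also have "\<dots> < 0" using x by simp
  finally show ?thesis .
qed

section \<open>Generating functions of words and loops\<close>

lemma suminf_geometric_ennreal_finite:
  assumes "0 \<le> C" "0 \<le> q" "q < 1"
  shows "(\<Sum>n. ennreal (C * q ^ n)) < \<infinity>"
proof -
  have "summable (\<lambda>n. C * q ^ n)" using assms by (intro summable_mult summable_geometric) simp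
  moreover have "0 \<le> C * q ^ n" for n using assms by simp
  ultimately have "(\<Sum>n. ennreal (C * q ^ n)) \<noteq> top" by (rule ennreal_suminf_neq_top)
  then show ?thesis unfolding infinity_ennreal_def less_top .
qed

lemma cylinder_append:
  assumes "\<omega> \<in> cylinder G (u @ w)"
  shows "\<omega> \<in> cylinder G u" "(shift ^^ length u) \<omega> \<in> cylinder G w"
proof -
  have "map \<omega> [0..<length u + length w] = map \<omega> [0..<length u] @ map (\<lambda>i. \<omega> (i + length u)) [0..<length w]"
    by (intro nth_equalityI) (auto simp: nth_append add.commute)
  then have "map \<omega> [0..<length u] = u \<and> map (\<lambda>i. \<omega> (i + length u)) [0..<length w] = w"
    using assms by (simp add: cylinder_def)
  then show "\<omega> \<in> cylinder G u" "(shift ^^ length u) \<omega> \<in> cylinder G w"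
    using assms path_space_funpow[of \<omega> G "length u"]
    by (simp_all add: cylinder_def) (simp_all add: shift_funpow)
qed

context distorted_gifs
begin

definition word_weight :: "real \<Rightarrow> 'v list \<Rightarrow> ennreal" where
  "word_weight s w = (SUP \<omega>\<in>cylinder G w. ennreal (exp (s * S (length w) \<omega>)))"

definition loop_weight :: "real \<Rightarrow> 'v \<Rightarrow> 'v list \<Rightarrow> ennreal" where
  "loop_weight s v L = (SUP \<omega>\<in>cylinder G (L @ [v]). ennreal (exp (s * S (length L) \<omega>)))"

lemma exp_birkhoff_add:
  "ennreal (exp (s * S (m + n) \<omega>)) = ennreal (exp (s * S m \<omega>)) * ennreal (exp (s * S n ((shift ^^ m) \<omega>)))"
  unfolding birkhoff_add distrib_left exp_add by (rule ennreal_mult) simp_all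

lemma word_weight_append: "word_weight s (u @ w) \<le> word_weight s u * word_weight s w"
  unfolding word_weight_def[of s "u @ w"] length_append exp_birkhoff_add
proof (rule SUP_least)
  fix \<omega> assume "\<omega> \<in> cylinder G (u @ w)"
  from cylinder_append[OF this]
  show "ennreal (exp (s * S (length u) \<omega>)) * ennreal (exp (s * S (length w) ((shift ^^ length u) \<omega>)))
    \<le> word_weight s u * word_weight s w"
    unfolding word_weight_def by (intro mult_mono SUP_upper) simp_all
qed

text \<open>For the loop, the supremum only ranges over paths that return to \<open>v\<close> right after \<open>L\<close>. This is what
  makes its weight comparable to that of a single path through \<open>L\<close>.\<close>

lemma word_weight_loop_append:
  "word_weight s (L @ v # q) \<le> loop_weight s v L * word_weight s (v # q)"
  unfolding word_weight_def[of s "L @ v # q"] length_append exp_birkhoff_add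
proof (rule SUP_least)
  fix \<omega> assume \<omega>: "\<omega> \<in> cylinder G (L @ v # q)"
  then have "\<omega> \<in> cylinder G (L @ [v])" using cylinder_append(1)[of \<omega> G "L @ [v]" q] by simp
  with cylinder_append(2)[OF \<omega>]
  show "ennreal (exp (s * S (length L) \<omega>)) * ennreal (exp (s * S (length (v # q)) ((shift ^^ length L) \<omega>)))
    \<le> loop_weight s v L * word_weight s (v # q)"
    unfolding word_weight_def loop_weight_def by (intro mult_mono SUP_upper) simp_all
qed

lemma birkhoff_nonpos:
  assumes "\<omega> \<in> X"
  shows "S n \<omega> \<le> 0"
proof -
  have "n * ln r \<le> 0" using r by (intro mult_nonneg_nonpos) auto
  then show ?thesis using birkhoff_le[OF assms, of n] by linarith
qed

lemma word_weight_le_1: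
  assumes "0 \<le> s"
  shows "word_weight s w \<le> 1" "loop_weight s v w \<le> 1"
  unfolding word_weight_def loop_weight_def
  by (rule SUP_least; use assms birkhoff_nonpos in \<open>auto simp: cylinder_def mult_nonneg_nonpos\<close>)+

lemma partition_function_eq:
  assumes "0 \<le> s"
  shows "partition_function G (\<lambda>\<omega>. s * \<phi> \<omega>) n = infsum (word_weight s) {w \<in> lists (verts G). length w = n}"
  unfolding partition_function_def
proof (rule infsum_cong_neutral)
  fix w assume "w \<in> {w \<in> lists (verts G). length w = n} - {w. length w = n \<and> set w \<subseteq> verts G \<and> cylinder G w \<noteq> {}}"
  then have "cylinder G w = {}" by auto
  then show "word_weight s w = 0" by (simp add: word_weight_def bot_ennreal)
next
  fix w assume "w \<in> {w. length w = n \<and> set w \<subseteq> verts G \<and> cylinder G w \<noteq> {}} \<inter> {w \<in> lists (verts G). length w = n}"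
  then have w: "length w = n" "cylinder G w \<noteq> {}" by auto
  have le: "s * S n \<omega> \<le> 0" if "\<omega> \<in> cylinder G w" for \<omega>
    using that assms birkhoff_nonpos by (auto simp: cylinder_def mult_nonneg_nonpos)
  show "exp_ereal (SUP \<omega>\<in>cylinder G w. ereal (\<Sum>i<n. s * \<phi> ((shift ^^ i) \<omega>))) = word_weight s w"
    unfolding word_weight_def w(1) sum_distrib_left[symmetric]
    by (rule exp_ereal_SUP[OF w(2) le])
qed auto

lemma partition_function_submult:
  assumes "0 \<le> s"
  shows "partition_function G (\<lambda>\<omega>. s * \<phi> \<omega>) (m + n) \<le>
    partition_function G (\<lambda>\<omega>. s * \<phi> \<omega>) m * partition_function G (\<lambda>\<omega>. s * \<phi> \<omega>) n"
proof -
  let ?W = "\<lambda>n. {w \<in> lists (verts G). length w = n}"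
  have "infsum (word_weight s) (?W (m + n)) \<le>
    infsum (\<lambda>(u, w). word_weight s u * word_weight s w) (?W m \<times> ?W n)"
  proof (rule infsum_ennreal_le_of_cover[where k = "\<lambda>(u, w). u @ w"])
    fix w assume w: "w \<in> ?W (m + n)"
    show "\<exists>y\<in>?W m \<times> ?W n. (case y of (u, w) \<Rightarrow> u @ w) = w \<and>
        word_weight s w \<le> (case y of (u, w) \<Rightarrow> word_weight s u * word_weight s w)"
      using w word_weight_append[of s "take m w" "drop m w"]
      by (intro bexI[of _ "(take m w, drop m w)"]) (auto dest: in_set_takeD in_set_dropD)
  qed
  also note infsum_ennreal_Times_le
  finally show ?thesis unfolding partition_function_eq[OF assms] .
qed

definition gen_weight :: "real \<Rightarrow> real \<Rightarrow> 'v list \<Rightarrow> ennreal" where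
  "gen_weight s x w = ennreal (x ^ length w) * word_weight s w"

definition gen_loop_weight :: "real \<Rightarrow> real \<Rightarrow> 'v \<Rightarrow> 'v list \<Rightarrow> ennreal" where
  "gen_loop_weight s x v L = ennreal (x ^ length L) * loop_weight s v L"

lemma gen_weight_append:
  assumes "0 \<le> x"
  shows "gen_weight s x (u @ w) \<le> gen_weight s x u * gen_weight s x w"
  unfolding gen_weight_def length_append power_add
  using assms mult_left_mono[OF word_weight_append[of s u w], of "ennreal (x ^ length u) * ennreal (x ^ length w)"]
  by (simp add: ennreal_mult mult_ac)

lemma gen_weight_loop_append:
  assumes "0 \<le> x"
  shows "gen_weight s x (L @ v # q) \<le> gen_loop_weight s x v L * gen_weight s x (v # q)"
  unfolding gen_weight_def gen_loop_weight_def length_append power_add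
  using assms mult_left_mono[OF word_weight_loop_append[of s L v q],
      of "ennreal (x ^ length L) * ennreal (x ^ length (v # q))"]
  by (simp add: ennreal_mult mult_ac)

lemma gen_function_small_letters_finite:
  assumes s: "0 \<le> s" and x: "0 \<le> x" and q: "infsum (\<lambda>v. gen_weight s x [v]) R \<le> ennreal q" "0 \<le> q" "q < 1"
  shows "infsum (gen_weight s x) (lists R) < \<infinity>"
proof -
  have "infsum (gen_weight s x) {w \<in> lists R. length w = n} \<le> ennreal (q ^ n)" for n
  proof (induction n)
    case 0
    have "infsum (gen_weight s x) {w \<in> lists R. length w = 0} \<le> infsum (gen_weight s x) {[]}"
      by (rule infsum_ennreal_mono_set) auto
    then show ?case using word_weight_le_1(1)[OF s, of "[]"] by (simp add: gen_weight_def)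
  next
    case (Suc n)
    let ?W = "{w \<in> lists R. length w = n}"
    have "infsum (gen_weight s x) {w \<in> lists R. length w = Suc n} \<le>
      infsum (\<lambda>(v, w). gen_weight s x [v] * gen_weight s x w) (R \<times> ?W)"
    proof (rule infsum_ennreal_le_of_cover[where k = "\<lambda>(v, w). v # w"])
      fix w assume "w \<in> {w \<in> lists R. length w = Suc n}"
      then obtain v u where w: "w = v # u" "v \<in> R" "u \<in> ?W" by (cases w) auto
      then show "\<exists>y\<in>R \<times> ?W. (case y of (v, w) \<Rightarrow> v # w) = w \<and>
          gen_weight s x w \<le> (case y of (v, w) \<Rightarrow> gen_weight s x [v] * gen_weight s x w)"
        using gen_weight_append[OF x, of s "[v]" u] by (intro bexI[of _ "(v, u)"]) auto
    qed
    also have "\<dots> \<le> infsum (\<lambda>v. gen_weight s x [v]) R * infsum (gen_weight s x) ?W"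
      by (rule infsum_ennreal_Times_le)
    also have "\<dots> \<le> ennreal q * ennreal (q ^ n)"
      by (intro mult_mono q Suc) auto
    also have "\<dots> = ennreal (q ^ Suc n)" using q by (simp add: ennreal_mult)
    finally show ?case .
  qed
  then have "infsum (gen_weight s x) (lists R) \<le> (\<Sum>n. ennreal (q ^ n))"
    by (rule infsum_ennreal_le_suminf_length)
  also have "\<dots> < \<infinity>"
    using suminf_geometric_ennreal_finite[OF zero_le_one q(2,3)] unfolding mult_1 .
  finally show ?thesis .
qed

text \<open>Cut a word containing \<open>v\<close> at its first and at its last occurrence of \<open>v\<close>. The middle part \<open>L\<close>
  between them is empty (if \<open>v\<close> occurs once) or starts with \<open>v\<close>; the condition \<open>hd (L @ [v]) = v\<close> says
  both at once.\<close>

lemma gen_function_insert: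
  assumes s: "0 \<le> s" and x: "0 \<le> x"
  shows "infsum (gen_weight s x) (lists (insert v A)) \<le>
    infsum (gen_weight s x) (lists A) + infsum (gen_weight s x) (lists A) *
      (infsum (gen_loop_weight s x v) {L. hd (L @ [v]) = v} *
        (gen_weight s x [v] * infsum (gen_weight s x) (lists A)))"
proof -
  let ?g = "gen_weight s x" and ?l = "gen_loop_weight s x v" and ?\<Lambda> = "{L. hd (L @ [v]) = v}"
  let ?P = "{w \<in> lists (insert v A). v \<notin> set w}" and ?Q = "{w \<in> lists (insert v A). v \<in> set w}"
  let ?h = "\<lambda>(p, L, q). ?g p * (?l L * (?g [v] * ?g q))"
  have "infsum ?g ?Q \<le> infsum ?h (lists A \<times> ?\<Lambda> \<times> lists A)"
  proof (rule infsum_ennreal_le_of_cover[where k = "\<lambda>(p, L, q). p @ L @ v # q"])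
    fix w assume w: "w \<in> ?Q"
    then obtain p w' where p: "w = p @ v # w'" "v \<notin> set p" by (auto dest: split_list_first)
    have "v \<in> set (v # w')" by simp
    then obtain L q where q: "v # w' = L @ v # q" "v \<notin> set q" by (meson split_list_last)
    have hd: "hd (L @ [v]) = v" using q(1) by (cases L) auto
    have wq: "w = p @ L @ v # q" using p q by simp
    have "p \<in> lists A" "q \<in> lists A" using w p(2) q(2) unfolding wq by auto
    moreover have "?g w \<le> ?g p * (?l L * (?g [v] * ?g q))"
    proof -
      have "?g w \<le> ?g p * ?g (L @ v # q)" unfolding wq by (rule gen_weight_append[OF x])
      also have "\<dots> \<le> ?g p * (?l L * ?g (v # q))"
        by (intro mult_left_mono gen_weight_loop_append[OF x]) auto
      also have "\<dots> \<le> ?g p * (?l L * (?g [v] * ?g q))"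
        using gen_weight_append[OF x, of s "[v]" q] by (intro mult_left_mono) auto
      finally show ?thesis .
    qed
    ultimately show "\<exists>y\<in>lists A \<times> ?\<Lambda> \<times> lists A. (case y of (p, L, q) \<Rightarrow> p @ L @ v # q) = w \<and> ?g w \<le> ?h y"
      using wq hd by (intro bexI[of _ "(p, L, q)"]) auto
  qed
  also have "?h = (\<lambda>(p, y). ?g p * (case y of (L, q) \<Rightarrow> ?l L * (?g [v] * ?g q)))" by auto
  also have "infsum \<dots> (lists A \<times> ?\<Lambda> \<times> lists A) \<le>
      infsum ?g (lists A) * infsum (\<lambda>(L, q). ?l L * (?g [v] * ?g q)) (?\<Lambda> \<times> lists A)"
    by (rule infsum_ennreal_Times_le)
  also have "\<dots> \<le> infsum ?g (lists A) * (infsum ?l ?\<Lambda> * infsum (\<lambda>q. ?g [v] * ?g q) (lists A))"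
    by (intro mult_left_mono infsum_ennreal_Times_le) auto
  also have "infsum (\<lambda>q. ?g [v] * ?g q) (lists A) = ?g [v] * infsum ?g (lists A)"
    by (rule cmult_infsum_ennreal[symmetric])
  finally have Q: "infsum ?g ?Q \<le> infsum ?g (lists A) * (infsum ?l ?\<Lambda> * (?g [v] * infsum ?g (lists A)))" .
  have "lists (insert v A) = ?P \<union> ?Q" by auto
  then have "infsum ?g (lists (insert v A)) = infsum ?g ?P + infsum ?g ?Q"
    using infsum_Un_disjoint[OF ennreal_summable_on ennreal_summable_on, of ?P ?Q ?g] by auto
  also have "\<dots> \<le> infsum ?g (lists A) + infsum ?g (lists A) * (infsum ?l ?\<Lambda> * (?g [v] * infsum ?g (lists A)))"
    by (intro add_mono Q infsum_ennreal_mono_set) auto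
  finally show ?thesis .
qed

lemma gen_function_finite:
  assumes s: "0 \<le> s" and x: "0 \<le> x" and "finite F"
    and loops: "\<And>v. v \<in> F \<Longrightarrow> infsum (gen_loop_weight s x v) {L. hd (L @ [v]) = v} < \<infinity>"
    and R: "infsum (gen_weight s x) (lists R) < \<infinity>"
  shows "infsum (gen_weight s x) (lists (F \<union> R)) < \<infinity>"
  using \<open>finite F\<close> loops
proof (induction F rule: finite_induct)
  case (insert v F)
  have "gen_weight s x [v] \<le> ennreal x * 1"
    unfolding gen_weight_def using word_weight_le_1(1)[OF s, of "[v]"] by (intro mult_mono) auto
  then have "gen_weight s x [v] < \<infinity>" by (simp add: order_le_less_trans)
  moreover have "infsum (gen_weight s x) (lists (F \<union> R)) < \<infinity>" using insert by auto
  moreover have "infsum (gen_loop_weight s x v) {L. hd (L @ [v]) = v} < \<infinity>" using insert by auto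
  ultimately show ?case
    using order_le_less_trans[OF gen_function_insert[OF s x, of v "F \<union> R"]]
    by (auto simp: ennreal_mult_less_top)
qed (use R in simp)

text \<open>The weight of a single letter is what summability over the vertices controls.\<close>

lemma infsum_word_weight_letters_le:
  assumes "0 \<le> s"
  shows "infsum (\<lambda>v. word_weight s [v]) (verts G) \<le>
    (\<Sum>\<^sub>\<infinity>v \<in> verts G. SUP u \<in> {u \<in> verts G. (v, u) \<in> arcs_ends G}. SUP x \<in> limit_set G J T \<inter> J u.
       ennreal (conorm (deriv_at (T (edge G v u)) x) powr s))"
proof (rule infsum_ennreal_mono_set[OF order_refl])
  fix v
  show "word_weight s [v] \<le> (SUP u \<in> {u \<in> verts G. (v, u) \<in> arcs_ends G}. SUP x \<in> limit_set G J T \<inter> J u.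
       ennreal (conorm (deriv_at (T (edge G v u)) x) powr s))"
    unfolding word_weight_def
  proof (rule SUP_least)
    fix \<omega> assume "\<omega> \<in> cylinder G [v]"
    then have \<omega>: "\<omega> \<in> X" "\<omega> 0 = v" by (auto simp: cylinder_def)
    have x: "\<pi> (shift \<omega>) \<in> limit_set G J T \<inter> J (\<omega> 1)"
      using coding_map_in_limit_set[OF path_space_shift[OF \<omega>(1)]] coding_map_in_J[OF path_space_shift[OF \<omega>(1)]]
      by (simp add: shift_def)
    have u: "\<omega> 1 \<in> {u \<in> verts G. (v, u) \<in> arcs_ends G}" using \<omega> by (auto simp: path_space_def)
    have "exp (s * S (length [v]) \<omega>) = exp (\<phi> \<omega>) powr s" by (simp add: powr_def)
    also have "exp (\<phi> \<omega>) = conorm (deriv_at (T (edge G v (\<omega> 1))) (\<pi> (shift \<omega>)))"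
      unfolding exp_potential[OF \<omega>(1)] \<omega>(2) ..
    finally have "exp (s * S (length [v]) \<omega>) = conorm (deriv_at (T (edge G v (\<omega> 1))) (\<pi> (shift \<omega>))) powr s" .
    then show "ennreal (exp (s * S (length [v]) \<omega>)) \<le>
      (SUP u \<in> {u \<in> verts G. (v, u) \<in> arcs_ends G}. SUP x \<in> limit_set G J T \<inter> J u.
       ennreal (conorm (deriv_at (T (edge G v u)) x) powr s))"
      by (intro SUP_upper2[OF u] SUP_upper2[OF x]) simp
  qed
qed

text \<open>If the measure vanishes, no finite set \<open>W\<close> of loops has \<open>\<Sum> w(L)\<^sup>t > 1\<close>, where \<open>w(L)\<close> is the
  value of \<open>exp (S\<^sub>n\<phi>)\<close> on one path through \<open>L\<close>, lowered by the distortion constant to hold for all such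
  paths. Passing from \<open>t\<close> to the larger exponent \<open>s\<close> gains \<open>exp ((s - t) S\<^sub>n\<phi>) \<le> r\<^sup>n\<^sup>(\<^sup>s\<^sup>-\<^sup>t\<^sup>)\<close>.\<close>

lemma loop_weight_sum_le:
  assumes H: "hausdorff_measure d (limit_set G J T) = 0" and d: "0 \<le> d" "d \<le> t" and t: "0 < t" "t \<le> s"
    and n: "0 < n"
  shows "infsum (loop_weight s v) {L. hd (L @ [v]) = v \<and> length L = n} \<le>
    ennreal (exp ((s + t) * distortion_const M) * (r powr (s - t)) ^ n)"
proof (rule infsum_ennreal_le)
  fix F assume F: "finite F" "F \<subseteq> {L. hd (L @ [v]) = v \<and> length L = n}"
  define W where "W = F \<inter> loops v n"
  define C where "C = distortion_const M"
  define B where "B = exp ((s + t) * C) * (r powr (s - t)) ^ n"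
  have B0: "0 \<le> B" by (simp add: B_def)
  define \<omega> where "\<omega> L = (SOME \<omega>. \<omega> \<in> cylinder G (L @ [v]))" for L
  define w where "w L = exp (S n (\<omega> L) - C)" for L
  have W: "finite W" "W \<subseteq> loops v n" using F by (auto simp: W_def)
  have \<omega>: "\<omega> L \<in> cylinder G (L @ [v])" if "L \<in> W" for L
    unfolding \<omega>_def some_in_eq using that by (simp add: W_def loops_def)
  have dist: "S n \<eta>' \<le> S n \<eta> + C" if "L \<in> W" "\<eta> \<in> cylinder G (L @ [v])" "\<eta>' \<in> cylinder G (L @ [v])" for L \<eta> \<eta>'
  proof -
    have "length L = n" using that by (auto simp: W_def loops_def)
    then have "map \<eta> [0..<Suc n] = map \<eta>' [0..<Suc n]" using that by (simp add: cylinder_def)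
    then show ?thesis unfolding C_def
      using that by (intro birkhoff_distortion) (auto simp: cylinder_def map_eq_conv simp del: upt_Suc)
  qed
  have w_le: "w L \<le> exp (S n \<eta>)" if "L \<in> W" "\<eta> \<in> cylinder G (L @ [v])" for L \<eta>
    using dist[OF that \<omega>[OF that(1)]] by (simp add: w_def)
  \<comment> \<open>split \<open>s S\<close> into \<open>t S\<close>, which becomes \<open>w L powr t\<close>, and the gain \<open>(s - t) S\<close>\<close>
  have lw: "loop_weight s v L \<le> ennreal (B * w L powr t)" if L: "L \<in> W" for L
    unfolding loop_weight_def
  proof (rule SUP_least)
    fix \<eta> assume \<eta>: "\<eta> \<in> cylinder G (L @ [v])"
    have len: "length L = n" using L by (auto simp: W_def loops_def)
    have X: "\<omega> L \<in> X" using \<omega>[OF L] by (simp add: cylinder_def)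
    have "s * S n \<eta> \<le> s * (S n (\<omega> L) + C)"
      using dist[OF L \<omega>[OF L] \<eta>] t by (intro mult_left_mono) auto
    also have "\<dots> = t * (S n (\<omega> L) - C) + (s + t) * C + (s - t) * S n (\<omega> L)" by (simp add: algebra_simps)
    also have "(s - t) * S n (\<omega> L) \<le> (s - t) * (n * ln r)"
      using birkhoff_le[OF X] t by (intro mult_left_mono) auto
    finally have "exp (s * S n \<eta>) \<le> exp (t * (S n (\<omega> L) - C) + (s + t) * C + (s - t) * (n * ln r))"
      by simp
    also have "\<dots> = B * w L powr t"
    proof -
      have "exp ((s - t) * (n * ln r)) = (r powr (s - t)) ^ n"
        using r by (simp add: powr_def exp_of_nat_mult[symmetric] mult_ac)
      then show ?thesis unfolding exp_add B_def w_def by (simp add: powr_def)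
    qed
    finally show "ennreal (exp (s * S (length L) \<eta>)) \<le> ennreal (B * w L powr t)"
      unfolding len by (rule ennreal_leI)
  qed
  have "(\<Sum>L\<in>W. w L powr t) \<le> 1"
  proof (rule ccontr)
    assume "\<not> ?thesis"
    then have "hausdorff_measure d (limit_set G J T) \<noteq> 0"
      using w_le t d by (intro hausdorff_measure_limit_set_pos[OF W n, of w t d]) (auto simp: w_def)
    with H show False by simp
  qed
  then have "B * (\<Sum>L\<in>W. w L powr t) \<le> B * 1" using B0 by (rule mult_left_mono)
  then have WB: "(\<Sum>L\<in>W. B * w L powr t) \<le> B" by (simp add: sum_distrib_left)
  have "sum (loop_weight s v) F = sum (loop_weight s v) W"
  proof (rule sum.mono_neutral_right)
    show "\<forall>L\<in>F - W. loop_weight s v L = 0"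
      using F by (auto simp: W_def loops_def loop_weight_def bot_ennreal)
  qed (use F in \<open>auto simp: W_def\<close>)
  also have "\<dots> \<le> (\<Sum>L\<in>W. ennreal (B * w L powr t))" by (intro sum_mono lw)
  also have "\<dots> = ennreal (\<Sum>L\<in>W. B * w L powr t)" using B0 by (intro sum_ennreal) simp
  also have "\<dots> \<le> ennreal B" using WB by (rule ennreal_leI)
  finally show "sum (loop_weight s v) F \<le> ennreal (exp ((s + t) * distortion_const M) * (r powr (s - t)) ^ n)"
    by (simp add: B_def C_def)
qed

lemma gen_loop_function_finite:
  assumes H: "hausdorff_measure d (limit_set G J T) = 0" and d: "0 \<le> d" "d \<le> t" and t: "0 < t" "t \<le> s"
    and x: "0 \<le> x" "x * r powr (s - t) < 1"
  shows "infsum (gen_loop_weight s x v) {L. hd (L @ [v]) = v} < \<infinity>"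
proof -
  define C where "C = max 1 (exp ((s + t) * distortion_const M))"
  define \<theta> where "\<theta> = x * r powr (s - t)"
  have \<theta>: "0 \<le> \<theta>" "\<theta> < 1" using x by (auto simp: \<theta>_def)
  have C: "0 \<le> C" by (simp add: C_def)
  have "infsum (gen_loop_weight s x v) {L \<in> {L. hd (L @ [v]) = v}. length L = n} \<le> ennreal (C * \<theta> ^ n)" for n
  proof (cases "n = 0")
    case True
    have "infsum (gen_loop_weight s x v) {L \<in> {L. hd (L @ [v]) = v}. length L = n}
        \<le> infsum (gen_loop_weight s x v) {[]}"
      by (rule infsum_ennreal_mono_set) (auto simp: True)
    also have "\<dots> \<le> ennreal C"
      using word_weight_le_1(2)[of s v "[]"] t
      by (simp add: gen_loop_weight_def C_def order_trans ennreal_leI[of 1, simplified])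
    finally show ?thesis using True by simp
  next
    case False
    let ?L = "{L. hd (L @ [v]) = v \<and> length L = n}"
    have "infsum (gen_loop_weight s x v) ?L = infsum (\<lambda>L. ennreal (x ^ n) * loop_weight s v L) ?L"
      by (rule infsum_cong) (auto simp: gen_loop_weight_def)
    also have "\<dots> = ennreal (x ^ n) * infsum (loop_weight s v) ?L"
      by (rule cmult_infsum_ennreal[symmetric])
    also have "\<dots> \<le> ennreal (x ^ n) * ennreal (C * (r powr (s - t)) ^ n)"
    proof (intro mult_left_mono)
      have "infsum (loop_weight s v) ?L \<le> ennreal (exp ((s + t) * distortion_const M) * (r powr (s - t)) ^ n)"
        using False by (intro loop_weight_sum_le[OF H d t]) simp
      also have "\<dots> \<le> ennreal (C * (r powr (s - t)) ^ n)"
        by (intro ennreal_leI mult_right_mono) (auto simp: C_def)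
      finally show "infsum (loop_weight s v) ?L \<le> ennreal (C * (r powr (s - t)) ^ n)" .
    qed auto
    also have "\<dots> = ennreal (C * \<theta> ^ n)"
      using x C by (simp add: ennreal_mult[symmetric] \<theta>_def power_mult_distrib mult_ac)
    finally show ?thesis by simp
  qed
  then have "infsum (gen_loop_weight s x v) {L. hd (L @ [v]) = v} \<le> (\<Sum>n. ennreal (C * \<theta> ^ n))"
    by (rule infsum_ennreal_le_suminf_length)
  also have "\<dots> < \<infinity>"
    by (rule suminf_geometric_ennreal_finite[OF C \<theta>])
  finally show ?thesis .
qed

text \<open>If the measure in a dimension \<open>d < s\<close> vanished, loops would be so light that the generating
  function of all words converges at some \<open>x > 1\<close>, and the pressure would be negative.\<close>

lemma dimension_ge_of_pressure_zero:
  assumes s: "s \<in> V_summability_exponents G J T" and P: "pressure G (\<lambda>\<omega>. s * \<phi> \<omega>) = 0"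
    and H: "hausdorff_measure d (limit_set G J T) = 0" and d: "0 \<le> d"
  shows "s \<le> d"
proof (rule ccontr)
  assume "\<not> s \<le> d"
  define t where "t = (d + s) / 2"
  have t: "0 < t" "d \<le> t" "t < s" "t \<le> s" and s0: "0 \<le> s" using d \<open>\<not> s \<le> d\<close> by (auto simp: t_def)
  let ?Z = "partition_function G (\<lambda>\<omega>. s * \<phi> \<omega>)"
  define \<theta> where "\<theta> = r powr (s - t)"
  have \<theta>: "0 < \<theta>" "\<theta> < 1" using r t powr_less_mono2[of "s - t" r 1] by (auto simp: \<theta>_def)
  \<comment> \<open>any \<open>x\<close> strictly between \<open>1\<close> and \<open>1 / \<theta>\<close> would do\<close>
  define x where "x = 2 / (1 + \<theta>)"
  have x: "1 < x" "x * \<theta> < 1" using \<theta> by (auto simp: x_def field_simps)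
  have "infsum (\<lambda>v. word_weight s [v]) (verts G) < \<infinity>"
    using order_le_less_trans[OF infsum_word_weight_letters_le[OF s0]] s
    by (auto simp: V_summability_exponents_def)
  \<comment> \<open>The letters outside \<open>F\<close> have weight at most \<open>1 / 2\<close> even after multiplication by \<open>x\<close>.\<close>
  then obtain F where F: "finite F" "F \<subseteq> verts G"
    and tail: "infsum (\<lambda>v. word_weight s [v]) (verts G - F) \<le> ennreal (1 / (2 * x))"
    using infsum_ennreal_small_tail[of "\<lambda>v. word_weight s [v]" "verts G" "1 / (2 * x)"] x by auto
  have "infsum (\<lambda>v. gen_weight s x [v]) (verts G - F) = ennreal x * infsum (\<lambda>v. word_weight s [v]) (verts G - F)"
    by (simp add: gen_weight_def cmult_infsum_ennreal)
  also have "\<dots> \<le> ennreal x * ennreal (1 / (2 * x))" by (intro mult_left_mono tail) auto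
  also have "\<dots> = ennreal (1 / 2)" using x by (simp add: ennreal_mult[symmetric])
  finally have "infsum (gen_weight s x) (lists (verts G - F)) < \<infinity>"
    using x by (intro gen_function_small_letters_finite[OF s0, of x "verts G - F" "1 / 2"]) auto
  then have "infsum (gen_weight s x) (lists (F \<union> (verts G - F))) < \<infinity>"
    using x \<theta>_def by (intro gen_function_finite[OF s0 _ F(1)] gen_loop_function_finite[OF H d t(2,1,4)]) auto
  then have gen: "infsum (gen_weight s x) (lists (verts G)) < \<infinity>" using F(2) by (simp add: Un_absorb1)
  then obtain B where B: "0 \<le> B" "infsum (gen_weight s x) (lists (verts G)) = ennreal B"
    by (cases "infsum (gen_weight s x) (lists (verts G))") auto
  have bound: "ennreal (x ^ n) * ?Z n \<le> ennreal B" for n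
  proof -
    let ?W = "{w \<in> lists (verts G). length w = n}"
    have "ennreal (x ^ n) * infsum (word_weight s) ?W = infsum (\<lambda>w. ennreal (x ^ n) * word_weight s w) ?W"
      by (rule cmult_infsum_ennreal)
    also have "\<dots> \<le> infsum (gen_weight s x) (lists (verts G))"
      by (rule infsum_ennreal_mono_set) (auto simp: gen_weight_def)
    finally show ?thesis unfolding partition_function_eq[OF s0] B(2) .
  qed
  have fin: "?Z n < \<infinity>" for n
  proof -
    have "1 * ?Z n \<le> ennreal (x ^ n) * ?Z n"
      using x by (intro mult_right_mono) (auto simp: one_le_power)
    then show ?thesis using bound[of n] by (simp add: order_le_less_trans order_trans)
  qed
  obtain L where L: "(\<lambda>n. ereal (1 / real n) * log_ennreal (?Z n)) \<longlonglongrightarrow> L"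
    using submultiplicative_growth_rate_converges[OF partition_function_submult[OF s0] fin] by blast
  \<comment> \<open>Convergence is essential here: it identifies the value of \<open>lim\<close> with an actual limit.\<close>
  then have "L = 0" using P limI[OF L] by (simp add: pressure_def)
  moreover have "L < 0" by (rule growth_rate_neg_of_geometric_bound[OF bound x(1) L])
  ultimately show False by simp
qed

end

section \<open>The dimension bound\<close>

theorem theorem3p8:
  fixes G :: "('v, 'e) pre_digraph"
    and J U :: "'v \<Rightarrow> (real ^ 'n) set"
    and T :: "'e \<Rightarrow> real ^ 'n \<Rightarrow> real ^ 'n"
  assumes "simple_gifs G J U T"
    and "strong_separation G J T"
    and "bounded_distortion G U T"
    and "bounded_distortion_inverse G U T"
    and "V_summable G J T"
  shows "lower_dim G J T \<le> hausdorff_dim (limit_set G J T)"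
proof -
  interpret simple_gifs G J U T by fact
  obtain r where r: "0 < r" "r < 1"
    "\<And>e x. e \<in> arcs G \<Longrightarrow> x \<in> U (head G e) \<Longrightarrow> onorm (deriv_at (T e) x) \<le> r"
    using T_contraction by blast
  obtain \<delta> where \<delta>: "0 < \<delta>" "\<And>v. v \<in> verts G \<Longrightarrow> \<delta> \<le> setdist (J v) (- U v)" using J_U_dist by blast
  have ball: "ball x \<delta> \<subseteq> U v" if "v \<in> verts G" "x \<in> J v" for v x
  proof
    fix y assume y: "y \<in> ball x \<delta>"
    show "y \<in> U v"
    proof (rule ccontr)
      assume "y \<notin> U v"
      then have "setdist (J v) (- U v) \<le> dist x y" using that by (intro setdist_le_dist) auto
      with \<delta>(2)[OF that(1)] y show False by simp
    qed
  qed
  obtain c \<beta> where c: "0 < c" "0 < \<beta>" and "\<forall>e\<in>arcs G. \<forall>x\<in>U (head G e). \<forall>y\<in>U (head G e).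
      \<bar>conorm (deriv_at (T e) x) - conorm (deriv_at (T e) y)\<bar>
        \<le> c * conorm (deriv_at (T e) x) * norm (x - y) powr \<beta>"
    using assms(4) unfolding bounded_distortion_inverse_def by blast
  note cb = this(3)[rule_format]
  obtain D where D: "\<And>v. v \<in> verts G \<Longrightarrow> diameter (J v) \<le> D"
    using J_diam unfolding bdd_above_def by blast
  have dist_D: "dist x y \<le> D" if "v \<in> verts G" "x \<in> J v" "y \<in> J v" for v x y
  proof -
    have "bounded (J v)" using J_set[OF that(1)] compact_imp_bounded by auto
    from order_trans[OF diameter_bounded_bound[OF this that(2,3)] D[OF that(1)]] show ?thesis .
  qed
  obtain M where M: "0 < M" "\<And>v (g :: real ^ 'n \<Rightarrow> real ^ 'n) \<rho> x y. v \<in> verts G \<Longrightarrow> 0 \<le> \<rho> \<Longrightarrow>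
      (\<And>x. x \<in> U v \<Longrightarrow> \<exists>g'. (g has_derivative g') (at x) \<and> onorm g' \<le> \<rho>) \<Longrightarrow>
      x \<in> J v \<Longrightarrow> y \<in> J v \<Longrightarrow> dist (g x) (g y) \<le> M * \<rho>"
  proof (rule connected_image_diameter_bound[OF \<delta>(1), where D = D and ?'a = "real ^ 'n"])
    fix M :: real assume M: "0 < M" and *: "\<And>J U (g :: real ^ 'n \<Rightarrow> real ^ 'n) \<rho> x y.
      connected J \<Longrightarrow> (\<And>x y. x \<in> J \<Longrightarrow> y \<in> J \<Longrightarrow> dist x y \<le> D) \<Longrightarrow>
      (\<And>x. x \<in> J \<Longrightarrow> ball x \<delta> \<subseteq> U) \<Longrightarrow> 0 \<le> \<rho> \<Longrightarrow>
      (\<And>x. x \<in> U \<Longrightarrow> \<exists>g'. (g has_derivative g') (at x) \<and> onorm g' \<le> \<rho>) \<Longrightarrow>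
      x \<in> J \<Longrightarrow> y \<in> J \<Longrightarrow> dist (g x) (g y) \<le> M * \<rho>"
    show thesis
    proof (rule that[OF M])
      fix v and g :: "real ^ 'n \<Rightarrow> real ^ 'n" and \<rho> x y
      assume v: "v \<in> verts G" and \<rho>: "0 \<le> \<rho>"
        and g: "\<And>x. x \<in> U v \<Longrightarrow> \<exists>g'. (g has_derivative g') (at x) \<and> onorm g' \<le> \<rho>"
        and xy: "x \<in> J v" "y \<in> J v"
      have "connected (J v)" using J_set[OF v] by simp
      from *[OF this dist_D[OF v] ball[OF v] \<rho> g xy] show "dist (g x) (g y) \<le> M * \<rho>" .
    qed
  qed
  interpret distorted_gifs G J U T r "\<delta> / 2" c \<beta> M
  proof unfold_locales
    show "cball x (\<delta> / 2) \<subseteq> U v" if "v \<in> verts G" "x \<in> J v" for v x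
      using ball[OF that] \<delta>(1) by (intro order_trans[OF _ ball[OF that]]) auto
    fix e x y assume e: "e \<in> arcs G" "x \<in> U (head G e)" "y \<in> U (head G e)"
    let ?A = "conorm (deriv_at (T e) x)"
    have "open (U (head G e))" using U_set e by simp
    from C1_diffeo_derivative(3)[OF T_diffeo[OF e(1)] this e(2)] have A: "0 < ?A" .
    have "conorm (deriv_at (T e) y) \<le> ?A * (1 + c * dist x y powr \<beta>)"
      using cb[OF e] by (simp add: dist_norm algebra_simps)
    also have "\<dots> \<le> ?A * exp (c * dist x y powr \<beta>)"
      using A by (intro mult_left_mono exp_ge_add_one_self) auto
    finally show "conorm (deriv_at (T e) y) \<le> ?A * exp (c * dist x y powr \<beta>)" .
  next
    fix v \<rho> x y and g :: "real ^ 'n \<Rightarrow> real ^ 'n"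
    assume "v \<in> verts G" "0 \<le> \<rho>" "\<And>x. x \<in> U v \<Longrightarrow> \<exists>g'. (g has_derivative g') (at x) \<and> onorm g' \<le> \<rho>"
      "x \<in> J v" "y \<in> J v"
    then show "dist (g x) (g y) \<le> M * \<rho>" by (rule M(2))
  qed (use r \<delta> c M(1) assms(2) in auto)
  obtain s where s: "s \<in> V_summability_exponents G J T" "pressure G (\<lambda>\<omega>. s * lower_potential G J T \<omega>) = 0"
    using assms(5) by (auto simp: V_summable_def)
  have "lower_dim G J T \<le> ereal s"
    unfolding lower_dim_def using s by (intro Inf_lower) (auto simp: V_summability_exponents_def)
  also have "ereal s \<le> hausdorff_dim (limit_set G J T)"
    unfolding hausdorff_dim_def
    by (rule Inf_greatest) (use dimension_ge_of_pressure_zero[OF s] in auto)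
  finally show ?thesis .
qed

end
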